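(* Let $F\in\mathcal{E}^m$, let $\mathcal{L}\subseteq\mathbb{S}^m$ be a linear subspace with orthonormal basis $A_1,\dots,A_d$, and let $L(\theta)=\sum_{i=1}^d\theta_iA_i$. Let $X_1,\dots,X_n$ be a random sample from $N_m(0,\Sigma_0)$, where $\Sigma_0\in\mathbb{S}^m_+$ and $\nabla F(\Sigma_0)\in\mathcal{L}\cap\mathbb{L}^m_+$, and let $\theta_0$ be the parameter with $L(\theta_0)=\nabla F(\Sigma_0)$. Assume that the Bregman estimator $\widehat\theta_n$ exists (almost surely). For $\epsilon>0$, let $\mu>0$ be such that $\overline{M}$ is $\mu$-strongly convex in the $\epsilon$-ball. Then $$\mathbb{P}(\|\widehat\theta_n-\theta_0\|>\epsilon)\;\le\;\begin{cases}2d\exp\Big\{-\dfrac{\mu^2\epsilon^2n}{32\,d\,\|\Sigma_0\|^2}\Big\}&\text{if }\epsilon\le\dfrac{2\|\Sigma_0\|\sqrt d}{\mu}\ ,\\[3mm]2d\exp\Big\{-\dfrac{\mu\epsilon n}{16\sqrt d\,\|\Sigma_0\|}\Big\}&\text{otherwise.}\end{cases}$$ In particular, for any $\delta\in(0,1)$, if $n\ge 8\log(\tfrac{2d}{\delta})$ and $\overline{M}$ is $\mu$-strongly convex in the $\epsilon$-ball for $\epsilon=\frac{4\|\Sigma_0\|}{\mu}\sqrt{\frac{2d}{n}\log(\frac{2d}{\delta})}$, then $$\|\widehat\theta_n-\theta_0\|\;\le\;\frac{4\|\Sigma_0\|}{\mu}\sqrt{\frac{2d}{n}\log\Big(\frac{2d}{\delta}\Big)}$$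 with probability at least $1-\delta$.
   Context: $\mathbb{S}^m$ is the space of real symmetric $m\times m$ matrices with inner product $\langle A,B\rangle=\mathrm{tr}(AB)$ and Frobenius norm; $\mathbb{S}^m_+$ and $\overline{\mathbb{S}}^m_+$ are the subsets of positive definite and positive semidefinite matrices. $\mathcal{E}^m$ is the set of functions $F:\mathbb{S}^m\to\mathbb{R}\cup\{+\infty\}$ such that (i) $F$ is convex, not identically $+\infty$, and lower semicontinuous; (ii) $\mathbb{S}^m_+\subseteq\mathrm{dom}(F)\subseteq\overline{\mathbb{S}}^m_+$, where $\mathrm{dom}(F)=\{F<+\infty\}$; (iii) $F$ is strictly convex and continuously differentiable on $\mathbb{S}^m_+$. Gradients are with respect to $\langle\cdot,\cdot\rangle$. $\mathbb{L}^m_+:=\nabla F(\mathbb{S}^m_+)$, and $F^*(L)=\sup_{\Sigma\in\mathbb{S}^m}\{\langle\Sigma,L\rangle-F(\Sigma)\}$. $\Theta_+=\{\theta\in\mathbb{R}^d:L(\theta)\in\mathbb{L}^m_+\}$. The sample covariance matrix is $S_n=\frac1n\sum_{i=1}^nX_iX_i^\top$. The Bregman estimator $\widehat\theta_n$ is the (unique, if it exists) minimizer over $\theta\in\Theta_+$ of $M_n(\theta)=F^*(L(\theta))-\langle L(\theta),S_n\rangle$. Put $M(\theta)=F^*(L(\theta))-\langle L(\theta),\Sigma_0\rangle$ and $\overline{M}(\omega)=M(\theta_0+\omega)-M(\theta_0)$ for $\omega\in\mathbb{R}^d$. "$\overline{M}$ is $\mu$-strongly convex in the $\epsilon$-ball"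 means that $\omega\mapsto\overline{M}(\omega)-\frac{\mu}{2}\|\omega\|^2$ is convex on $\{\omega:\|\omega\|\le\epsilon\}$. For vectors $\|\cdot\|$ is the Euclidean norm, for matrices the operator (spectral) norm. *)

theory Defs
  imports "HOL-Probability.Probability"
begin

text \<open>Matrix spaces. The dimension is the cardinality of the index type.\<close>

definition sym_mats :: "(real^'m^'m) set" where
  "sym_mats = {A. transpose A = A}"

definition pd_mats :: "(real^'m^'m) set" where
  "pd_mats = {A \<in> sym_mats. \<forall>x. x \<noteq> 0 \<longrightarrow> x \<bullet> (A *v x) > 0}"

definition psd_mats :: "(real^'m^'m) set" where
  "psd_mats = {A \<in> sym_mats. \<forall>x. x \<bullet> (A *v x) \<ge> 0}"

definition tr_inner :: "real^'m^'m \<Rightarrow> real^'m^'m \<Rightarrow> real" where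
  "tr_inner A B = trace (A ** B)"

definition op_norm :: "real^'m^'m \<Rightarrow> real" where
  "op_norm A = onorm (\<lambda>x. A *v x)"


text \<open>
  Functions with values in the reals extended by \<open>\<infinity>\<close> are modelled with type \<open>ereal\<close>, the
  value \<open>-\<infinity>\<close> being excluded where it matters. The library's \<open>convex_on\<close> covers only
  real-valued functions. In \<open>ereal\<close> one has \<open>0 * \<infinity> = 0\<close>, so the inequality below is
  harmless for \<open>u = 0\<close> or \<open>v = 0\<close>.
\<close>

definition ereal_convex_on :: "'a::real_vector set \<Rightarrow> ('a \<Rightarrow> ereal) \<Rightarrow> bool" where
  "ereal_convex_on S f \<longleftrightarrow> convex S \<and>
     (\<forall>x\<in>S. \<forall>y\<in>S. \<forall>u\<ge>0. \<forall>v\<ge>0. u + v = 1 \<longrightarrow>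
        f (u *\<^sub>R x + v *\<^sub>R y) \<le> ereal u * f x + ereal v * f y)"

definition ereal_strictly_convex_on :: "'a::real_vector set \<Rightarrow> ('a \<Rightarrow> ereal) \<Rightarrow> bool" where
  "ereal_strictly_convex_on S f \<longleftrightarrow> convex S \<and>
     (\<forall>x\<in>S. \<forall>y\<in>S. \<forall>u>0. \<forall>v>0. x \<noteq> y \<longrightarrow> u + v = 1 \<longrightarrow>
        f (u *\<^sub>R x + v *\<^sub>R y) < ereal u * f x + ereal v * f y)"

definition lower_semicontinuous_on ::
    "'a::topological_space set \<Rightarrow> ('a \<Rightarrow> ereal) \<Rightarrow> bool" where
  "lower_semicontinuous_on S f \<longleftrightarrow> (\<forall>x\<in>S. f x \<le> Liminf (at x within S) f)"


text \<open>
  The gradient is taken in the Euclidean space of symmetric matrices, hence the Frechet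
  derivative within \<open>sym_mats\<close> and the requirement that the gradient be symmetric. Values of
  \<open>F\<close> outside \<open>sym_mats\<close> play no role anywhere. Near a point where the gradient is used,
  \<open>F\<close> is finite on symmetric matrices, so \<open>real_of_ereal\<close> loses nothing.
\<close>

definition has_sym_gradient :: "(real^'m^'m \<Rightarrow> ereal) \<Rightarrow> real^'m^'m \<Rightarrow> real^'m^'m \<Rightarrow> bool" where
  "has_sym_gradient F G X \<longleftrightarrow> G \<in> sym_mats \<and>
     ((\<lambda>Y. real_of_ereal (F Y)) has_derivative (\<lambda>H. tr_inner G H)) (at X within sym_mats)"

definition sym_gradient :: "(real^'m^'m \<Rightarrow> ereal) \<Rightarrow> real^'m^'m \<Rightarrow> real^'m^'m" where
  "sym_gradient F X = (THE G. has_sym_gradient F G X)"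

lemma tr_inner_self_eq_0:
  assumes "A \<in> sym_mats" "tr_inner A A = 0"
  shows "A = 0"
proof -
  have "A $ i $ j = A $ j $ i" for i j
    using assms(1) unfolding sym_mats_def transpose_def by (auto simp: vec_eq_iff)
  then have "tr_inner A A = A \<bullet> A"
    by (simp add: tr_inner_def trace_def matrix_matrix_mult_def inner_vec_def)
  with assms(2) show ?thesis by simp
qed

lemma has_sym_gradient_unique:
  assumes "X \<in> sym_mats" "has_sym_gradient F G1 X" "has_sym_gradient F G2 X"
  shows "G1 = G2"
proof -
  define H where "H = G1 - G2"
  have H: "H \<in> sym_mats"
    using assms(2,3) unfolding has_sym_gradient_def sym_mats_def H_def transpose_def
    by (auto simp: vec_eq_iff)
  have line: "range (\<lambda>t::real. X + t *\<^sub>R H) \<subseteq> sym_mats"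
    using assms(1) H unfolding sym_mats_def transpose_def by (auto simp: vec_eq_iff)
  have d: "((\<lambda>t::real. X + t *\<^sub>R H) has_derivative (\<lambda>t. t *\<^sub>R H)) (at 0)"
    by (auto intro!: derivative_eq_intros)
  have c: "((\<lambda>t. real_of_ereal (F (X + t *\<^sub>R H))) has_derivative (\<lambda>t. tr_inner G (t *\<^sub>R H))) (at 0)"
    if "has_sym_gradient F G X" for G
    using has_derivative_in_compose[OF d, of "\<lambda>Y. real_of_ereal (F Y)" "\<lambda>H. tr_inner G H"]
      that line has_derivative_subset[OF _ line]
    unfolding has_sym_gradient_def by auto
  have "tr_inner G1 H = tr_inner G2 H"
    using has_derivative_unique[OF c[OF assms(2)] c[OF assms(3)]]
    by (metis scaleR_one)
  then have "tr_inner H H = 0"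
    by (simp add: H_def tr_inner_def matrix_matrix_mult_def trace_def
        left_diff_distrib sum_subtractf)
  then show ?thesis
    using tr_inner_self_eq_0[OF H] by (simp add: H_def)
qed

lemma sym_gradient_eqI:
  "X \<in> sym_mats \<Longrightarrow> has_sym_gradient F G X \<Longrightarrow> sym_gradient F X = G"
  unfolding sym_gradient_def using has_sym_gradient_unique by blast

definition bregman_class :: "(real^'m^'m \<Rightarrow> ereal) set" where
  "bregman_class = {F.
     (\<forall>X\<in>sym_mats. F X \<noteq> -\<infinity>) \<and>
     ereal_convex_on sym_mats F \<and>
     (\<exists>X\<in>sym_mats. F X \<noteq> \<infinity>) \<and>
     lower_semicontinuous_on sym_mats F \<and>
     pd_mats \<subseteq> {X\<in>sym_mats. F X < \<infinity>} \<and>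
     {X\<in>sym_mats. F X < \<infinity>} \<subseteq> psd_mats \<and>
     ereal_strictly_convex_on pd_mats F \<and>
     (\<forall>X\<in>pd_mats. \<exists>G. has_sym_gradient F G X) \<and>
     continuous_on pd_mats (sym_gradient F)}"

definition gradient_domain :: "(real^'m^'m \<Rightarrow> ereal) \<Rightarrow> (real^'m^'m) set" where
  "gradient_domain F = sym_gradient F ` pd_mats"

definition sym_conjugate :: "(real^'m^'m \<Rightarrow> ereal) \<Rightarrow> real^'m^'m \<Rightarrow> ereal" where
  "sym_conjugate F L = (SUP X\<in>sym_mats. ereal (tr_inner X L) - F X)"


definition lin_param :: "('d::finite \<Rightarrow> real^'m^'m) \<Rightarrow> real^'d \<Rightarrow> real^'m^'m" where
  "lin_param A \<theta> = (\<Sum>i\<in>UNIV. (\<theta> $ i) *\<^sub>R A i)"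

definition tr_orthonormal_basis :: "('d::finite \<Rightarrow> real^'m^'m) \<Rightarrow> (real^'m^'m) set \<Rightarrow> bool" where
  "tr_orthonormal_basis A V \<longleftrightarrow>
     (\<forall>i j. tr_inner (A i) (A j) = (if i = j then 1 else 0)) \<and> span (range A) = V"

definition param_domain ::
    "(real^'m^'m \<Rightarrow> ereal) \<Rightarrow> ('d::finite \<Rightarrow> real^'m^'m) \<Rightarrow> (real^'d) set" where
  "param_domain F A = {\<theta>. lin_param A \<theta> \<in> gradient_domain F}"

text \<open>
  With \<open>S\<close> the sample covariance matrix this is the empirical loss \<open>M\<^sub>n\<close>; with \<open>S\<close> the true
  covariance matrix it is the population loss \<open>M\<close>.
\<close>

definition bregman_loss ::
    "(real^'m^'m \<Rightarrow> ereal) \<Rightarrow> ('d::finite \<Rightarrow> real^'m^'m) \<Rightarrow> real^'m^'m \<Rightarrow> real^'d \<Rightarrow> ereal" where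
  "bregman_loss F A S \<theta> =
     sym_conjugate F (lin_param A \<theta>) - ereal (tr_inner (lin_param A \<theta>) S)"

definition is_bregman_estimate ::
    "(real^'m^'m \<Rightarrow> ereal) \<Rightarrow> ('d::finite \<Rightarrow> real^'m^'m) \<Rightarrow> real^'m^'m \<Rightarrow> real^'d \<Rightarrow> bool" where
  "is_bregman_estimate F A S \<theta> \<longleftrightarrow> \<theta> \<in> param_domain F A \<and>
     (\<forall>\<theta>'\<in>param_domain F A. bregman_loss F A S \<theta> \<le> bregman_loss F A S \<theta>')"

definition excess_loss ::
    "(real^'m^'m \<Rightarrow> ereal) \<Rightarrow> ('d::finite \<Rightarrow> real^'m^'m) \<Rightarrow> real^'m^'m \<Rightarrow> real^'d \<Rightarrow> real^'d \<Rightarrow> ereal"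
  where
  "excess_loss F A S \<theta>0 \<omega> = bregman_loss F A S (\<theta>0 + \<omega>) - bregman_loss F A S \<theta>0"

definition strongly_convex_in_ball ::
    "real \<Rightarrow> real \<Rightarrow> ('a::real_normed_vector \<Rightarrow> ereal) \<Rightarrow> bool" where
  "strongly_convex_in_ball \<mu> \<epsilon> f \<longleftrightarrow>
     ereal_convex_on {\<omega>. norm \<omega> \<le> \<epsilon>} (\<lambda>\<omega>. f \<omega> - ereal (\<mu> / 2 * (norm \<omega>)\<^sup>2))"


definition mvnormal_density :: "real^'m \<Rightarrow> real^'m^'m \<Rightarrow> real^'m \<Rightarrow> real" where
  "mvnormal_density m \<Sigma> x =
     exp (- ((x - m) \<bullet> (matrix_inv \<Sigma> *v (x - m))) / 2) / sqrt ((2 * pi) ^ CARD('m) * det \<Sigma>)"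

definition sample_cov :: "nat \<Rightarrow> (nat \<Rightarrow> real^'m) \<Rightarrow> real^'m^'m" where
  "sample_cov n x = (1 / real n) *\<^sub>R (\<Sum>i=1..n. \<chi> j k. x i $ j * x i $ k)"

end

theory Submission
  imports Defs
begin

text \<open>
  If the estimate is farther than \<open>\<epsilon>\<close> from \<open>\<theta>\<^sub>0\<close>, then by convexity of the conjugate the empirical
  loss is at most its value at \<open>\<theta>\<^sub>0\<close> at the point \<open>\<theta>\<^sub>0 + \<omega>\<close> with \<open>norm \<omega> = \<epsilon>\<close> on the segment from
  \<open>\<theta>\<^sub>0\<close> to the estimate. The empirical and the population loss differ there by the linear term
  \<open>\<langle>L(\<omega>), S\<^sub>n - \<Sigma>\<^sub>0\<rangle>\<close>. The population loss is minimal at \<open>\<theta>\<^sub>0\<close> by the Fenchel--Young inequality, so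
  strong convexity makes it exceed its minimum by at least \<open>\<mu> \<epsilon>\<^sup>2 / 2\<close> at \<open>\<theta>\<^sub>0 + \<omega>\<close>. Hence
  \<open>\<mu> \<epsilon> / 2\<close> is a lower bound for the norm of the vector with coordinates
  \<open>\<langle>A\<^sub>i, S\<^sub>n - \<Sigma>\<^sub>0\<rangle>\<close>, and one of these \<open>d\<close> coordinates has absolute value at least
  \<open>\<mu> \<epsilon> / (2 \<surd>d)\<close> (\<open>bregman_estimate_outside_ball_coordinate\<close>). No differentiability of the
  conjugate is needed.

  Each coordinate is an average of \<open>n\<close> independent centred Gaussian quadratic forms. A linear
  map that whitens \<open>\<Sigma>\<^sub>0\<close> and diagonalises \<open>A\<^sub>i\<close> turns such a form into
  \<open>\<Sum>\<^sub>j l\<^sub>j (z\<^sub>j\<^sup>2 - 1)\<close> with independent standard normal \<open>z\<^sub>j\<close> and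
  \<open>\<Sum>\<^sub>j l\<^sub>j\<^sup>2 = tr (A\<^sub>i \<Sigma>\<^sub>0 A\<^sub>i \<Sigma>\<^sub>0) \<le> K\<^sup>2\<close>, where \<open>K\<close> is the spectral norm of \<open>\<Sigma>\<^sub>0\<close>. Its moment generating
  function at \<open>s\<close> is therefore at most \<open>exp (2 s\<^sup>2 K\<^sup>2)\<close> for \<open>\<bar>s\<bar> \<le> 1 / (4 K)\<close>
  (\<open>mvnormal_quadratic_form_mgf_le\<close>). Chernoff's inequality with this restriction on \<open>s\<close> produces the
  two regimes (\<open>sample_cov_deviation_two_sided_tail\<close>), and a union bound over the coordinates and
  the two signs gives the factor \<open>2 d\<close>.
\<close>

section \<open>Diagonalisation of symmetric matrices\<close>

text \<open>A maximiser of the Rayleigh quotient on an invariant subspace is an eigenvector.\<close>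

lemma self_adjoint_eigenvector_in_subspace:
  fixes f :: "'a::euclidean_space \<Rightarrow> 'a"
  assumes lin: "linear f" and sa: "\<And>x y. f x \<bullet> y = x \<bullet> f y"
    and W: "subspace W" "W \<noteq> {0}" and inv: "\<And>x. x \<in> W \<Longrightarrow> f x \<in> W"
  obtains v l where "v \<in> W" "norm v = 1" "f v = l *\<^sub>R v"
proof -
  let ?K = "W \<inter> sphere 0 1"
  have "compact ?K"
    by (intro closed_Int_compact closed_subspace W compact_sphere)
  moreover have "?K \<noteq> {}"
  proof -
    obtain w where w: "w \<in> W" "w \<noteq> 0"
      using W subspace_0 by blast
    then have "(1 / norm w) *\<^sub>R w \<in> ?K"
      using W(1) by (simp add: subspace_scale)
    then show ?thesis by blast
  qed
  moreover have "continuous_on ?K (\<lambda>x. x \<bullet> f x)"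
    by (intro continuous_intros linear_continuous_on) (use lin linear_conv_bounded_linear in blast)
  ultimately obtain v where v: "v \<in> W" "norm v = 1"
    and vmax: "\<And>x. x \<in> W \<Longrightarrow> norm x = 1 \<Longrightarrow> x \<bullet> f x \<le> v \<bullet> f v"
    using continuous_attains_sup[of ?K "\<lambda>x. x \<bullet> f x"] by (force simp: Ball_def)
  define l where "l = v \<bullet> f v"
  define w where "w = f v - l *\<^sub>R v"
  have wW: "w \<in> W"
    unfolding w_def by (intro subspace_diff subspace_scale W inv v)
  have vv: "v \<bullet> v = 1" using v(2) by (simp add: norm_eq_1)
  have vw: "v \<bullet> w = 0"
    by (simp add: w_def inner_diff_right vv l_def)
  have wfv: "w \<bullet> f v = w \<bullet> w"
    using vw by (simp add: w_def algebra_simps inner_diff_right inner_commute)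
  have quad: "x \<bullet> f x \<le> l * (x \<bullet> x)" if "x \<in> W" for x
  proof (cases "x = 0")
    case True
    then show ?thesis using lin by (simp add: linear_0)
  next
    case False
    let ?y = "(1 / norm x) *\<^sub>R x"
    have "?y \<bullet> f ?y \<le> l"
      unfolding l_def using False that W(1) by (intro vmax) (auto simp: subspace_scale)
    moreover have "?y \<bullet> f ?y = (x \<bullet> f x) / (x \<bullet> x)"
      using lin by (simp add: linear_cmul power2_eq_square flip: power2_norm_eq_inner)
    ultimately have "(x \<bullet> f x) / (x \<bullet> x) \<le> l" by simp
    then show ?thesis
      using False by (simp add: pos_divide_le_eq)
  qed
  \<comment> \<open>First-order optimality of \<open>v\<close> in the direction of the residual \<open>w\<close> forces \<open>w = 0\<close>.\<close>
  have key: "2 * (w \<bullet> w) \<le> t * (l * (w \<bullet> w) - w \<bullet> f w)" if "t > 0" for t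
  proof -
    have "(v + t *\<^sub>R w) \<bullet> f (v + t *\<^sub>R w) \<le> l * ((v + t *\<^sub>R w) \<bullet> (v + t *\<^sub>R w))"
      by (intro quad subspace_add subspace_scale W v wW)
    moreover have "v \<bullet> f w = w \<bullet> w"
      using sa[of v w] wfv by (simp add: inner_commute)
    ultimately have "l + t * (w \<bullet> w) + t * (w \<bullet> w + t * (w \<bullet> f w)) \<le> l * (1 + t * (t * (w \<bullet> w)))"
      using lin vw wfv vv
      by (simp add: linear_add linear_cmul inner_add_left inner_add_right l_def[symmetric]
          inner_commute[of w v] algebra_simps)
    then have "t * (2 * (w \<bullet> w)) \<le> t * (t * (l * (w \<bullet> w) - w \<bullet> f w))"
      by (simp add: algebra_simps)
    then show ?thesis using that by simp
  qed
  have "w \<bullet> w \<le> 0"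
  proof (rule ccontr)
    assume "\<not> w \<bullet> w \<le> 0"
    define c where "c = \<bar>l * (w \<bullet> w) - w \<bullet> f w\<bar>"
    define t where "t = (w \<bullet> w) / (c + 1)"
    have "c \<ge> 0" by (simp add: c_def)
    then have "t > 0"
      unfolding t_def using \<open>\<not> w \<bullet> w \<le> 0\<close> by (intro divide_pos_pos) linarith+
    have "2 * (w \<bullet> w) \<le> t * c"
      using key[OF \<open>t > 0\<close>] \<open>t > 0\<close> by (smt (verit) c_def mult_left_mono)
    also have "\<dots> \<le> w \<bullet> w"
      using \<open>c \<ge> 0\<close> by (simp add: t_def divide_simps distrib_left)
    finally show False using \<open>\<not> w \<bullet> w \<le> 0\<close> by simp
  qed
  then have "w = 0"
    using inner_ge_zero[of w] by (metis antisym inner_eq_zero_iff)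
  then have "f v = l *\<^sub>R v"
    by (simp add: w_def)
  with v that show ?thesis by blast
qed

text \<open>
  An orthonormal set of eigenvectors of maximal cardinality spans the space: otherwise its
  orthogonal complement is a nonzero invariant subspace, which contains a further eigenvector.
\<close>

lemma self_adjoint_orthonormal_eigenbasis:
  fixes f :: "'a::euclidean_space \<Rightarrow> 'a"
  assumes lin: "linear f" and sa: "\<And>x y. f x \<bullet> y = x \<bullet> f y"
  obtains B where "pairwise orthogonal B" "\<forall>b\<in>B. norm b = 1" "\<forall>b\<in>B. \<exists>l. f b = l *\<^sub>R b"
    "finite B" "card B = DIM('a)"
proof -
  define P where "P B \<longleftrightarrow> pairwise orthogonal B \<and> (\<forall>b\<in>B. norm b = 1 \<and> (\<exists>l. f b = l *\<^sub>R b))"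
    for B :: "'a set"
  have ind: "independent B" if "P B" for B
    using that unfolding P_def by (intro pairwise_orthogonal_independent) auto
  have fin: "finite B \<and> card B \<le> DIM('a)" if "P B" for B
    using ind[OF that] independent_bound by blast
  have "\<exists>B. P B \<and> (\<forall>C. P C \<longrightarrow> card C \<le> card B)"
  proof (rule ex_has_greatest_nat[where k = "{}" and b = "Suc DIM('a)"])
    show "P {}" by (simp add: P_def)
    show "\<forall>y. P y \<longrightarrow> card y < Suc DIM('a)" using fin by (simp add: less_Suc_eq_le)
  qed
  then obtain B where B: "P B" and Bmax: "\<And>C. P C \<Longrightarrow> card C \<le> card B" by blast
  define W where "W = {x. \<forall>b\<in>B. orthogonal b x}"
  have W: "subspace W"
    unfolding W_def by (auto simp: subspace_def orthogonal_def inner_add_right)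
  have inv: "f x \<in> W" if "x \<in> W" for x
    unfolding W_def
  proof (intro CollectI ballI)
    fix b assume "b \<in> B"
    then obtain l where "f b = l *\<^sub>R b" using B unfolding P_def by blast
    then show "orthogonal b (f x)"
      using that \<open>b \<in> B\<close> sa[of b x] unfolding W_def orthogonal_def by simp
  qed
  have "W = {0}"
  proof (rule ccontr)
    assume "W \<noteq> {0}"
    from self_adjoint_eigenvector_in_subspace[OF lin sa W this inv]
    obtain v l where v: "v \<in> W" "norm v = 1" "f v = l *\<^sub>R v" by blast
    have "v \<notin> B"
    proof
      assume "v \<in> B"
      then have "orthogonal v v" using v(1) unfolding W_def by blast
      then show False using v(2) by (simp add: orthogonal_self)
    qed
    have "P (insert v B)"
      using B v unfolding P_def W_def by (auto simp: pairwise_insert orthogonal_commute)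
    from Bmax[OF this] show False
      using \<open>v \<notin> B\<close> fin[OF B] by simp
  qed
  have "span B = UNIV"
  proof (rule ccontr)
    assume "span B \<noteq> UNIV"
    then obtain a where "a \<noteq> 0" "\<And>x. x \<in> span B \<Longrightarrow> a \<bullet> x = 0"
      using span_not_UNIV_orthogonal[of B] by blast
    then have "a \<in> W"
      unfolding W_def orthogonal_def by (simp add: inner_commute span_base)
    with \<open>W = {0}\<close> \<open>a \<noteq> 0\<close> show False by simp
  qed
  then have "card B = DIM('a)"
    using ind[OF B] dim_eq_card_independent[of B] dim_UNIV dim_span by metis
  with B fin[OF B] show ?thesis
    by (intro that[of B]) (auto simp: P_def)
qed

text \<open>The diagonal matrix with the entries of a given vector on its diagonal.\<close>

definition diag_matrix :: "real^'n \<Rightarrow> real^'n^'n" where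
  "diag_matrix l = (\<chi> i j. if i = j then l $ i else 0)"

lemma diag_matrix_mult: "diag_matrix l ** diag_matrix k = diag_matrix (\<chi> i. l $ i * k $ i)"
proof -
  have "(\<Sum>r\<in>UNIV. (if i = r then l $ i else 0) * (if r = j then k $ r else 0)) =
      (\<Sum>r\<in>UNIV. if r = i then (if i = j then l $ i * k $ i else 0) else 0)" for i j
    by (rule sum.cong) auto
  then show ?thesis
    by (simp add: diag_matrix_def matrix_matrix_mult_def vec_eq_iff)
qed

lemma transpose_diag_matrix: "transpose (diag_matrix l) = diag_matrix l"
  by (simp add: diag_matrix_def transpose_def vec_eq_iff)

lemma diag_matrix_1: "diag_matrix (\<chi> i. 1) = mat 1"
  by (simp add: diag_matrix_def mat_def vec_eq_iff)

lemma trace_diag_matrix: "trace (diag_matrix l) = (\<Sum>i\<in>UNIV. l $ i)"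
  by (simp add: diag_matrix_def trace_def)

lemma inner_diag_matrix: "x \<bullet> (diag_matrix l *v x) = (\<Sum>i\<in>UNIV. l $ i * (x $ i)\<^sup>2)"
proof -
  have "(\<Sum>j\<in>UNIV. (if i = j then l $ i else 0) * x $ j) = (\<Sum>j\<in>UNIV. if j = i then l $ i * x $ i else 0)"
    for i
    by (rule sum.cong) auto
  then show ?thesis
    by (simp add: diag_matrix_def matrix_vector_mult_def inner_vec_def power2_eq_square mult_ac)
qed

lemma trace_matrix_mult_commute: "trace (A ** B) = trace (B ** (A::real^'n^'n))"
  unfolding trace_def matrix_matrix_mult_def
  by (simp add: mult.commute) (rule sum.swap)

lemma inner_transpose_matrix_vector: "x \<bullet> ((transpose B :: real^'n^'m) *v y) = (B *v x) \<bullet> y"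
  by (metis dot_lmul_matrix inner_commute transpose_matrix_vector)

lemma symmetric_inner_commute:
  assumes "transpose A = (A::real^'n^'n)"
  shows "(A *v x) \<bullet> y = x \<bullet> (A *v y)"
  using inner_transpose_matrix_vector[of x A y] assms by simp

lemma inner_transpose_conjugate:
  "x \<bullet> ((transpose T ** A ** T) *v x) = (T *v x) \<bullet> (A *v ((T::real^'n^'n) *v x))"
proof -
  have "(transpose T ** A ** T) *v x = transpose T *v (A *v (T *v x))"
    by (simp only: matrix_vector_mul_assoc matrix_mul_assoc)
  then show ?thesis by (simp only: inner_transpose_matrix_vector)
qed

lemma symmetric_matrix_diagonalization:
  assumes sym: "transpose A = (A::real^'n^'n)"
  obtains U l where "orthogonal_matrix U" "transpose U ** A ** U = diag_matrix l"
proof -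
  obtain B where B: "pairwise orthogonal B" "\<forall>b\<in>B. norm b = 1" "\<forall>b\<in>B. \<exists>l. A *v b = l *\<^sub>R b"
    "finite B" "card B = DIM(real^'n)"
    using self_adjoint_orthonormal_eigenbasis[of "\<lambda>x. A *v x", OF matrix_vector_mul_linear
        symmetric_inner_commute[OF sym]] .
  have "card (UNIV::'n set) = card B" using B(5) by simp
  then obtain h where h: "bij_betw h (UNIV::'n set) B"
    using B(4) finite_same_card_bij[of "UNIV::'n set" B] by auto
  then have hB: "h i \<in> B" for i by (auto simp: bij_betw_def)
  have "\<forall>i. \<exists>l. A *v h i = l *\<^sub>R h i" using B(3) hB by blast
  then obtain l where l: "\<And>i. A *v h i = l i *\<^sub>R h i" by metis
  have orth: "h i \<bullet> h j = (if i = j then 1 else 0)" for i j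
  proof (cases "i = j")
    case True
    then show ?thesis using B(2) hB by (simp add: norm_eq_1)
  next
    case False
    then have "h i \<noteq> h j" using h by (auto simp: bij_betw_def inj_on_def)
    then show ?thesis using False B(1) hB[of i] hB[of j] by (simp add: pairwise_def orthogonal_def)
  qed
  define U :: "real^'n^'n" where "U = (\<chi> i j. h j $ i)"
  have U: "transpose U ** U = mat 1"
    using orth by (simp add: U_def transpose_def matrix_matrix_mult_def vec_eq_iff mat_def
        inner_vec_def)
  have AU: "A ** U = (\<chi> i j. l j * h j $ i)"
  proof -
    have "(A ** U) $ i $ j = (A *v h j) $ i" for i j
      by (simp add: U_def matrix_matrix_mult_def matrix_vector_mult_def)
    then show ?thesis by (simp add: vec_eq_iff l)
  qed
  have "(transpose U ** (A ** U)) $ i $ j = l j * (h i \<bullet> h j)" for i j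
    unfolding AU
    by (simp add: U_def transpose_def matrix_matrix_mult_def inner_vec_def sum_distrib_left
        mult.left_commute)
  then have "transpose U ** A ** U = diag_matrix (\<chi> i. l i)"
    by (simp add: orth vec_eq_iff diag_matrix_def flip: matrix_mul_assoc)
  with U that[of U] show ?thesis by (simp add: orthogonal_matrix)
qed

text \<open>
  In the coordinates given by \<open>T\<close> a Gaussian vector with covariance \<open>\<Sigma>\<close> becomes standard
  while the quadratic form of \<open>A\<close> becomes diagonal.
\<close>

lemma simultaneous_diagonalization:
  assumes \<Sigma>: "\<Sigma> \<in> pd_mats" and A: "A \<in> sym_mats"
  obtains T S :: "real^'n^'n" and l where "T ** S = mat 1" "S ** T = mat 1" "T ** transpose T = (\<Sigma>::real^'n^'n)"
    "transpose T ** A ** T = diag_matrix l"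
proof -
  have "transpose \<Sigma> = \<Sigma>" using \<Sigma> by (simp add: pd_mats_def sym_mats_def)
  from symmetric_matrix_diagonalization[OF this]
  obtain U k where U: "orthogonal_matrix U" and k: "transpose U ** \<Sigma> ** U = diag_matrix k" .
  have UU: "transpose U ** U = mat 1" "U ** transpose U = mat 1"
    using U by (auto simp: orthogonal_matrix_def)
  have kpos: "k $ i > 0" for i
  proof -
    have "axis i 1 \<bullet> (diag_matrix k *v axis i 1) = (\<Sum>j\<in>UNIV. if j = i then k $ j else 0)"
      unfolding inner_diag_matrix by (intro sum.cong) (auto simp: axis_def)
    then have "k $ i = axis i 1 \<bullet> (diag_matrix k *v axis i 1)" by simp
    also have "\<dots> = (U *v axis i 1) \<bullet> (\<Sigma> *v (U *v axis i 1))"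
      by (simp only: k[symmetric] inner_transpose_conjugate)
    also have "\<dots> > 0"
    proof -
      have "U *v axis i 1 \<noteq> 0"
      proof
        assume "U *v axis i 1 = 0"
        then have "transpose U *v (U *v axis i 1) = 0" by (simp only: matrix_vector_mult_0_right)
        then have "(axis i 1 :: real^'n) = 0" by (simp only: matrix_vector_mul_assoc UU matrix_vector_mul_lid)
        then show False by (simp add: axis_eq_0_iff)
      qed
      then show ?thesis using \<Sigma> by (simp add: pd_mats_def)
    qed
    finally show ?thesis .
  qed
  define D where "D = diag_matrix (\<chi> i. sqrt (k $ i))"
  define D' where "D' = diag_matrix (\<chi> i. 1 / sqrt (k $ i))"
  have k0: "k $ i \<noteq> 0" "k $ i \<ge> 0" for i using kpos[of i] by auto
  have DD: "D ** D = diag_matrix k" "D ** D' = mat 1" "D' ** D = mat 1" "transpose D = D"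
    using k0 by (simp_all add: D_def D'_def diag_matrix_mult transpose_diag_matrix
        diag_matrix_1[symmetric])
  \<comment> \<open>\<open>R\<close> is a square root of \<open>\<Sigma>\<close> in the sense that \<open>R R\<^sup>T = \<Sigma>\<close>; rotating it keeps this property.\<close>
  define R where "R = U ** D"
  define R' where "R' = D' ** transpose U"
  have RR': "R ** R' = mat 1" "R' ** R = mat 1"
  proof -
    have "R ** R' = U ** (D ** D') ** transpose U"
      by (simp only: R_def R'_def matrix_mul_assoc)
    then show "R ** R' = mat 1" by (simp add: DD UU)
    then show "R' ** R = mat 1" by (simp add: matrix_left_right_inverse)
  qed
  have RR: "R ** transpose R = \<Sigma>"
  proof -
    have "R ** transpose R = U ** (D ** D) ** transpose U"
      by (simp only: R_def matrix_transpose_mul DD(4) matrix_mul_assoc)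
    also have "\<dots> = (U ** transpose U) ** \<Sigma> ** (U ** transpose U)"
      by (simp only: DD k[symmetric] matrix_mul_assoc)
    finally show ?thesis by (simp add: UU)
  qed
  have "transpose (transpose R ** A ** R) = transpose R ** A ** R"
    using A by (simp add: matrix_transpose_mul matrix_mul_assoc sym_mats_def)
  from symmetric_matrix_diagonalization[OF this]
  obtain V l where V: "orthogonal_matrix V"
    and l: "transpose V ** (transpose R ** A ** R) ** V = diag_matrix l" .
  have VV: "transpose V ** V = mat 1" "V ** transpose V = mat 1"
    using V by (auto simp: orthogonal_matrix_def)
  define T where "T = R ** V"
  define S where "S = transpose V ** R'"
  have "T ** S = R ** (V ** transpose V) ** R'"
    by (simp only: T_def S_def matrix_mul_assoc)
  then have TS: "T ** S = mat 1" by (simp add: VV RR')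
  moreover from TS have "S ** T = mat 1" by (simp add: matrix_left_right_inverse)
  moreover have "T ** transpose T = R ** (V ** transpose V) ** transpose R"
    by (simp only: T_def matrix_transpose_mul matrix_mul_assoc)
  then have "T ** transpose T = \<Sigma>" by (simp add: VV RR)
  moreover have "transpose T ** A ** T = diag_matrix l"
    by (simp only: T_def matrix_transpose_mul l[symmetric] matrix_mul_assoc)
  ultimately show ?thesis using that by blast
qed

section \<open>Gaussian quadratic forms\<close>

lemma nn_integral_lborel_translate:
  fixes f :: "'a::euclidean_space \<Rightarrow> ennreal"
  assumes [measurable]: "f \<in> borel_measurable borel"
  shows "(\<integral>\<^sup>+x. f (c + x) \<partial>lborel) = (\<integral>\<^sup>+x. f x \<partial>lborel)"
proof -
  have "(\<integral>\<^sup>+x. f x \<partial>lborel) = (\<integral>\<^sup>+x. f x \<partial>distr lborel borel ((+) c))"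
    by (simp only: lborel_distr_plus)
  also have "\<dots> = (\<integral>\<^sup>+x. f (c + x) \<partial>lborel)"
    by (subst nn_integral_distr) auto
  finally show ?thesis by simp
qed

text \<open>
  Linear changes of variables up to the Jacobian. The argument is that for the uniqueness of
  translation-invariant measures: both sides equal \<open>\<integral>\<integral> f (S x) g y\<close>, by translations in \<open>x\<close> and \<open>y\<close> that
  turn the integrand first into \<open>f (y + S x) g y\<close>, then into \<open>f y g (y - S x)\<close> and finally into
  \<open>f y g (- S x)\<close>. The Jacobian is the ratio of the two integrals of \<open>g\<close>; for a probability density it
  follows from the total mass, without computing a determinant.
\<close>

lemma nn_integral_lborel_linear_product:
  fixes S T :: "'a::euclidean_space \<Rightarrow> 'a" and f g :: "'a \<Rightarrow> ennreal"
  assumes S: "linear S" and ST: "\<And>y. S (T y) = y"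
    and [measurable]: "f \<in> borel_measurable borel" "g \<in> borel_measurable borel"
  shows "(\<integral>\<^sup>+x. f (S x) \<partial>lborel) * (\<integral>\<^sup>+y. g y \<partial>lborel) =
    (\<integral>\<^sup>+x. g (- S x) \<partial>lborel) * (\<integral>\<^sup>+y. f y \<partial>lborel)"
proof -
  have [measurable]: "S \<in> borel_measurable borel"
    using S by (intro borel_measurable_continuous_onI linear_continuous_on)
      (simp add: linear_conv_bounded_linear)
  have "(\<integral>\<^sup>+x. f (S x) \<partial>lborel) * (\<integral>\<^sup>+y. g y \<partial>lborel) =
      (\<integral>\<^sup>+y. (\<integral>\<^sup>+x. f (S x) \<partial>lborel) * g y \<partial>lborel)"
    by (simp add: nn_integral_cmult)
  also have "\<dots> = (\<integral>\<^sup>+y. (\<integral>\<^sup>+x. f (S x) * g y \<partial>lborel) \<partial>lborel)"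
    by (simp add: nn_integral_multc)
  also have "\<dots> = (\<integral>\<^sup>+y. (\<integral>\<^sup>+x. f (y + S x) * g y \<partial>lborel) \<partial>lborel)"
  proof (rule nn_integral_cong)
    fix y
    show "(\<integral>\<^sup>+x. f (S x) * g y \<partial>lborel) = (\<integral>\<^sup>+x. f (y + S x) * g y \<partial>lborel)"
      using nn_integral_lborel_translate[of "\<lambda>x. f (S x) * g y" "T y"] S ST
      by (simp add: linear_add)
  qed
  also have "\<dots> = (\<integral>\<^sup>+x. (\<integral>\<^sup>+y. f (y + S x) * g y \<partial>lborel) \<partial>lborel)"
    by (rule lborel_pair.Fubini') measurable
  also have "\<dots> = (\<integral>\<^sup>+x. (\<integral>\<^sup>+y. f y * g (y - S x) \<partial>lborel) \<partial>lborel)"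
  proof (rule nn_integral_cong)
    fix x
    show "(\<integral>\<^sup>+y. f (y + S x) * g y \<partial>lborel) = (\<integral>\<^sup>+y. f y * g (y - S x) \<partial>lborel)"
      using nn_integral_lborel_translate[of "\<lambda>y. f y * g (y - S x)" "S x"]
      by (simp add: add.commute)
  qed
  also have "\<dots> = (\<integral>\<^sup>+y. (\<integral>\<^sup>+x. f y * g (y - S x) \<partial>lborel) \<partial>lborel)"
    by (rule lborel_pair.Fubini'[symmetric]) measurable
  also have "\<dots> = (\<integral>\<^sup>+y. f y * (\<integral>\<^sup>+x. g (y - S x) \<partial>lborel) \<partial>lborel)"
    by (simp add: nn_integral_cmult)
  also have "\<dots> = (\<integral>\<^sup>+y. f y * (\<integral>\<^sup>+x. g (- S x) \<partial>lborel) \<partial>lborel)"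
  proof (rule nn_integral_cong)
    fix y
    show "f y * (\<integral>\<^sup>+x. g (y - S x) \<partial>lborel) = f y * (\<integral>\<^sup>+x. g (- S x) \<partial>lborel)"
      using nn_integral_lborel_translate[of "\<lambda>x. g (y - S x)" "T y"] S ST
      by (simp add: linear_add)
  qed
  also have "\<dots> = (\<integral>\<^sup>+x. g (- S x) \<partial>lborel) * (\<integral>\<^sup>+y. f y \<partial>lborel)"
    by (simp add: nn_integral_multc mult.commute)
  finally show ?thesis .
qed

lemma nn_integral_lborel_vec_prod:
  fixes f :: "'n::finite \<Rightarrow> real \<Rightarrow> ennreal"
  assumes [measurable]: "\<And>i. f i \<in> borel_measurable borel"
  shows "(\<integral>\<^sup>+x. (\<Prod>i\<in>UNIV. f i (x $ i)) \<partial>(lborel :: (real^'n) measure)) = (\<Prod>i\<in>UNIV. \<integral>\<^sup>+t. f i t \<partial>lborel)"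
proof -
  have B: "(Basis :: (real^'n) set) = range (\<lambda>i. axis i 1)"
    by (auto simp: Basis_vec_def)
  have inj: "inj (\<lambda>i::'n. axis i (1::real))"
    by (auto simp: inj_def axis_eq_axis)
  have "(\<integral>\<^sup>+x. (\<Prod>b\<in>Basis. f (axis_index b) (x \<bullet> b)) \<partial>(lborel :: (real^'n) measure)) =
      (\<Prod>b\<in>(Basis :: (real^'n) set). \<integral>\<^sup>+t. f (axis_index b) t \<partial>lborel)"
    by (rule nn_integral_lborel_prod) auto
  then show ?thesis
    by (simp add: B prod.reindex[OF inj] inner_axis)
qed

text \<open>The density of the standard normal distribution on \<open>\<real>\<^sup>n\<close>.\<close>

definition std_normal_vec_density :: "real^'n \<Rightarrow> real" where
  "std_normal_vec_density z = (\<Prod>i\<in>UNIV. std_normal_density (z $ i))"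

lemma std_normal_vec_density_nonneg: "0 \<le> std_normal_vec_density z"
  by (simp add: std_normal_vec_density_def prod_nonneg)

lemma borel_measurable_std_normal_vec_density [measurable]:
  "std_normal_vec_density \<in> borel_measurable borel"
  unfolding std_normal_vec_density_def[abs_def] by measurable

lemma std_normal_vec_density_eq:
  "std_normal_vec_density (z :: real^'n) = (1 / sqrt (2 * pi)) ^ CARD('n) * exp (- (z \<bullet> z) / 2)"
  by (simp add: std_normal_vec_density_def std_normal_density_def prod_dividef exp_sum[symmetric]
      inner_vec_def power2_eq_square sum_negf sum_divide_distrib power_one_over)

lemma nn_integral_normal_density:
  "\<sigma> > 0 \<Longrightarrow> (\<integral>\<^sup>+x. ennreal (normal_density \<mu> \<sigma> x) \<partial>lborel) = 1"
  by (subst nn_integral_eq_integral) (auto simp: integral_normal_density)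

lemma nn_integral_std_normal_vec_density:
  "(\<integral>\<^sup>+z. ennreal (std_normal_vec_density z) \<partial>(lborel :: (real^'n) measure)) = 1"
  using nn_integral_lborel_vec_prod[of "\<lambda>i::'n. \<lambda>t. ennreal (std_normal_density t)"]
  by (simp add: std_normal_vec_density_def prod_ennreal nn_integral_normal_density)

lemma matrix_inv_eqI:
  fixes A B :: "real^'n^'n"
  assumes "A ** B = mat 1" "B ** A = mat 1"
  shows "matrix_inv A = B"
proof -
  have "A ** matrix_inv A = mat 1 \<and> matrix_inv A ** A = mat 1"
    unfolding matrix_inv_def by (rule someI[of _ B]) (use assms in blast)
  moreover have "matrix_inv A = matrix_inv A ** (A ** B)"
    by (simp add: assms)
  ultimately show ?thesis by (simp add: matrix_mul_assoc)
qed

lemma borel_measurable_matrix_vector_mult [measurable]: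
  "(\<lambda>x. (A::real^'n^'m) *v x) \<in> borel_measurable borel"
  by (intro borel_measurable_continuous_onI linear_continuous_on matrix_vector_mul_bounded_linear)

text \<open>A centred Gaussian vector with covariance \<open>T T\<^sup>T\<close> is the image under \<open>T\<close> of a standard one.\<close>

lemma nn_integral_centred_mvnormal:
  fixes X :: "'a \<Rightarrow> real^'m" and T S :: "real^'m^'m" and h :: "real^'m \<Rightarrow> ennreal"
  assumes "prob_space M"
    and X: "distributed M lborel X (\<lambda>x. ennreal (mvnormal_density 0 \<Sigma> x))"
    and TS: "T ** S = mat 1" "S ** T = mat 1" "T ** transpose T = \<Sigma>"
    and [measurable]: "h \<in> borel_measurable borel"
  shows "(\<integral>\<^sup>+\<omega>. h (X \<omega>) \<partial>M) = (\<integral>\<^sup>+z. ennreal (std_normal_vec_density z) * h (T *v z) \<partial>lborel)"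
proof -
  interpret prob_space M by fact
  have "\<Sigma> ** (transpose S ** S) = T ** (transpose T ** transpose S) ** S"
    by (simp only: TS(3)[symmetric] matrix_mul_assoc)
  also have "\<dots> = mat 1"
    by (simp only: matrix_transpose_mul[symmetric] TS transpose_mat matrix_mul_rid)
  finally have "\<Sigma> ** (transpose S ** S) = mat 1" .
  then have inv: "matrix_inv \<Sigma> = transpose S ** S"
    by (intro matrix_inv_eqI) (auto simp: matrix_left_right_inverse)
  have quad: "x \<bullet> (matrix_inv \<Sigma> *v x) = (S *v x) \<bullet> (S *v x)" for x
  proof -
    have "matrix_inv \<Sigma> *v x = transpose S *v (S *v x)"
      by (simp only: inv matrix_vector_mul_assoc)
    then show ?thesis by (simp only: inner_transpose_matrix_vector)
  qed
  define K where "K = (1 / sqrt (2 * pi)) ^ CARD('m)"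
  define C where "C = 1 / (sqrt ((2 * pi) ^ CARD('m) * det \<Sigma>) * K)"
  have "K > 0" by (simp add: K_def)
  have dens: "mvnormal_density 0 \<Sigma> x = C * std_normal_vec_density (S *v x)" for x
    using \<open>K > 0\<close>
    by (simp add: mvnormal_density_def quad std_normal_vec_density_eq K_def[symmetric] C_def)
  have "C \<ge> 0"
  proof -
    have "det \<Sigma> = (det T)\<^sup>2"
      by (simp add: TS(3)[symmetric] det_mul det_transpose power2_eq_square)
    then show ?thesis using \<open>K > 0\<close> by (simp add: C_def)
  qed
  let ?s = "\<lambda>z. ennreal (std_normal_vec_density z)"
  have ST: "S *v (T *v y) = y" "T *v (S *v y) = y" for y
    by (simp_all only: matrix_vector_mul_assoc TS matrix_vector_mul_lid)
  have even: "?s (- z) = ?s z" for z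
    by (simp add: std_normal_vec_density_eq)
  define J where "J = (\<integral>\<^sup>+x. ?s (S *v x) \<partial>lborel)"
  have main: "(\<integral>\<^sup>+\<omega>. k (X \<omega>) \<partial>M) = (ennreal C * J) * (\<integral>\<^sup>+z. ?s z * k (T *v z) \<partial>lborel)"
    if [measurable]: "k \<in> borel_measurable borel" for k
  proof -
    have "(\<integral>\<^sup>+\<omega>. k (X \<omega>) \<partial>M) = (\<integral>\<^sup>+x. ennreal (mvnormal_density 0 \<Sigma> x) * k x \<partial>lborel)"
      using distributed_nn_integral[OF X, of k] by simp
    also have "\<dots> = (\<integral>\<^sup>+x. ennreal C * (?s (S *v x) * k (T *v (S *v x))) \<partial>lborel)"
      using \<open>C \<ge> 0\<close> by (simp add: dens ennreal_mult std_normal_vec_density_nonneg ST mult.assoc)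
    also have "\<dots> = ennreal C * (\<integral>\<^sup>+x. ?s (S *v x) * k (T *v (S *v x)) \<partial>lborel)"
      by (rule nn_integral_cmult) measurable
    also have "(\<integral>\<^sup>+x. ?s (S *v x) * k (T *v (S *v x)) \<partial>lborel) =
        J * (\<integral>\<^sup>+z. ?s z * k (T *v z) \<partial>lborel)"
      using nn_integral_lborel_linear_product[of "(*v) S" "(*v) T" "\<lambda>z. ?s z * k (T *v z)" ?s]
      by (simp add: ST even J_def nn_integral_std_normal_vec_density)
    finally show ?thesis by (simp add: mult.assoc)
  qed
  \<comment> \<open>The constant is found by integrating the function \<open>1\<close>.\<close>
  have "ennreal C * J = 1"
    using main[of "\<lambda>_. 1"] by (simp add: nn_integral_std_normal_vec_density emeasure_space_1)
  with main[of h] show ?thesis by simp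
qed

lemma ln_one_minus_ge_quadratic:
  fixes u :: real
  assumes "\<bar>u\<bar> \<le> 1 / 2"
  shows "- u - u\<^sup>2 \<le> ln (1 - u)"
proof (cases "u \<le> 0")
  case True
  then show ?thesis using assms ln_one_plus_pos_lower_bound[of "- u"] by simp
next
  case False
  have "\<exists>y. ((\<lambda>x. ln (1 - x) + x + x\<^sup>2) has_real_derivative y) (at x) \<and> y \<ge> 0"
    if "0 \<le> x" "x \<le> u" for x
  proof (intro exI conjI)
    have "1 - x > 0" using that assms by simp
    then show "((\<lambda>x. ln (1 - x) + x + x\<^sup>2) has_real_derivative (x * (1 - 2 * x) / (1 - x))) (at x)"
      by (auto intro!: derivative_eq_intros simp: divide_simps) (simp add: algebra_simps)
    show "x * (1 - 2 * x) / (1 - x) \<ge> 0"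
      using that assms \<open>1 - x > 0\<close> by simp
  qed
  with False have "ln (1 - 0) + 0 + 0\<^sup>2 \<le> ln (1 - u) + u + u\<^sup>2"
    by (intro DERIV_nonneg_imp_nondecreasing[where f = "\<lambda>x. ln (1 - x) + x + x\<^sup>2"]) auto
  then show ?thesis by simp
qed

text \<open>
  The moment generating function of a centred \<open>\<chi>\<^sup>2\<close> variable with one degree of freedom: the
  integral equals \<open>exp (- a) / sqrt (1 - 2 a)\<close>.
\<close>

lemma nn_integral_std_normal_exp_centred_square_le:
  fixes a :: real
  assumes "\<bar>a\<bar> \<le> 1 / 4"
  shows "(\<integral>\<^sup>+t. ennreal (std_normal_density t * exp (a * (t\<^sup>2 - 1))) \<partial>lborel) \<le> ennreal (exp (2 * a\<^sup>2))"
proof -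
  have pos: "1 - 2 * a > 0" using assms by simp
  define \<sigma> where "\<sigma> = 1 / sqrt (1 - 2 * a)"
  have "\<sigma> > 0" using pos by (simp add: \<sigma>_def)
  have s2: "\<sigma>\<^sup>2 = 1 / (1 - 2 * a)" using pos by (simp add: \<sigma>_def power_divide)
  have "std_normal_density t * exp (a * (t\<^sup>2 - 1)) = (exp (- a) * \<sigma>) * normal_density 0 \<sigma> t" for t
  proof -
    have "normal_density 0 \<sigma> t = 1 / (sqrt (2 * pi) * \<sigma>) * exp (- (t\<^sup>2 * (1 - 2 * a)) / 2)"
    proof -
      have "sqrt (2 * pi * \<sigma>\<^sup>2) = sqrt (2 * pi) * \<sigma>"
        using \<open>\<sigma> > 0\<close> by (simp add: real_sqrt_mult)
      moreover have "- (t - 0)\<^sup>2 / (2 * \<sigma>\<^sup>2) = - (t\<^sup>2 * (1 - 2 * a)) / 2"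
        by (simp add: s2)
      ultimately show ?thesis by (simp only: normal_density_def)
    qed
    then have "(exp (- a) * \<sigma>) * normal_density 0 \<sigma> t =
        1 / sqrt (2 * pi) * (exp (- a) * exp (- (t\<^sup>2 * (1 - 2 * a)) / 2))"
      using \<open>\<sigma> > 0\<close> by simp
    also have "exp (- a) * exp (- (t\<^sup>2 * (1 - 2 * a)) / 2) = exp (- t\<^sup>2 / 2) * exp (a * (t\<^sup>2 - 1))"
      unfolding exp_add[symmetric] by (simp add: field_simps)
    finally show ?thesis by (simp add: std_normal_density_def)
  qed
  then have "(\<integral>\<^sup>+t. ennreal (std_normal_density t * exp (a * (t\<^sup>2 - 1))) \<partial>lborel) =
      (\<integral>\<^sup>+t. ennreal (exp (- a) * \<sigma>) * ennreal (normal_density 0 \<sigma> t) \<partial>lborel)"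
    using \<open>\<sigma> > 0\<close> by (simp add: ennreal_mult[symmetric])
  also have "\<dots> = ennreal (exp (- a) * \<sigma>)"
    using \<open>\<sigma> > 0\<close> by (simp add: nn_integral_cmult nn_integral_normal_density)
  also have "exp (- a) * \<sigma> \<le> exp (2 * a\<^sup>2)"
  proof -
    have "ln (exp (- a) * \<sigma>) = - a - ln (1 - 2 * a) / 2"
      using pos by (simp add: \<sigma>_def ln_mult ln_div ln_sqrt)
    also have "\<dots> \<le> 2 * a\<^sup>2"
    proof -
      have "\<bar>2 * a\<bar> \<le> 1 / 2" using assms by linarith
      from ln_one_minus_ge_quadratic[OF this] show ?thesis by (simp add: power_mult_distrib)
    qed
    finally show ?thesis using \<open>\<sigma> > 0\<close> by (simp add: ln_ge_iff ln_le_cancel_iff[symmetric] del: ln_le_cancel_iff)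
  qed
  finally show ?thesis by (simp add: ennreal_leI)
qed

text \<open>Here \<open>norm\<close> is the Frobenius norm.\<close>

lemma norm_matrix_mult_symmetric_le:
  fixes A B :: "real^'n^'n"
  assumes B: "transpose B = B"
  shows "norm (A ** B) \<le> op_norm B * norm A"
proof -
  have row: "(A ** B) $ i = B *v (A $ i)" for i
  proof -
    have "B $ j $ k = B $ k $ j" for j k using B by (metis transpose_def vec_lambda_beta)
    then show ?thesis
      by (simp add: matrix_matrix_mult_def matrix_vector_mult_def vec_eq_iff mult.commute)
  qed
  have "norm (A ** B) = L2_set (\<lambda>i. norm (B *v (A $ i))) UNIV"
    by (simp add: norm_vec_def row)
  also have "\<dots> \<le> L2_set (\<lambda>i. op_norm B * norm (A $ i)) UNIV"
    unfolding op_norm_def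
    by (intro L2_set_mono onorm[OF matrix_vector_mul_bounded_linear]) auto
  also have "\<dots> = op_norm B * norm A"
    by (simp add: L2_set_right_distrib norm_vec_def op_norm_def onorm_pos_le)
  finally show ?thesis .
qed

lemma trace_mult_eq_inner: "trace (A ** B) = transpose A \<bullet> (B::real^'n^'n)"
  unfolding trace_def matrix_matrix_mult_def transpose_def inner_vec_def
  by simp (rule sum.swap)

lemma norm_transpose: "norm (transpose A) = norm (A::real^'n^'n)"
proof -
  have "transpose A \<bullet> transpose A = A \<bullet> A"
    unfolding transpose_def inner_vec_def by simp (rule sum.swap)
  then show ?thesis by (simp add: norm_eq_sqrt_inner)
qed

text \<open>
  The quadratic form \<open>x \<bullet> A x\<close> of a centred Gaussian vector, minus its mean, is
  sub-exponential. In the coordinates of the simultaneous diagonalisation it is the sum of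
  the \<open>l\<^sub>i (z\<^sub>i\<^sup>2 - 1)\<close>, and the squares of the \<open>l\<^sub>i\<close> sum up to \<open>tr (A \<Sigma> A \<Sigma>)\<close>.
\<close>

lemma mvnormal_quadratic_form_mgf_le:
  fixes X :: "'a \<Rightarrow> real^'m" and A \<Sigma> :: "real^'m^'m"
  assumes M: "prob_space M"
    and X: "distributed M lborel X (\<lambda>x. ennreal (mvnormal_density 0 \<Sigma> x))"
    and \<Sigma>: "\<Sigma> \<in> pd_mats" and A: "A \<in> sym_mats"
    and s: "\<bar>s\<bar> * (op_norm \<Sigma> * norm A) \<le> 1 / 4"
  shows "(\<integral>\<^sup>+\<omega>. ennreal (exp (s * (X \<omega> \<bullet> (A *v X \<omega>) - tr_inner A \<Sigma>))) \<partial>M)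
    \<le> ennreal (exp (2 * s\<^sup>2 * (op_norm \<Sigma> * norm A)\<^sup>2))"
proof -
  obtain T S :: "real^'m^'m" and l where TS: "T ** S = mat 1" "S ** T = mat 1" "T ** transpose T = \<Sigma>"
    and l: "transpose T ** A ** T = diag_matrix l"
    using simultaneous_diagonalization[OF \<Sigma> A] .
  define K where "K = op_norm \<Sigma> * norm A"
  have "K \<ge> 0"
    by (simp add: K_def op_norm_def onorm_pos_le)
  have sum_l: "(\<Sum>i\<in>UNIV. l $ i) = tr_inner A \<Sigma>"
  proof -
    have "(\<Sum>i\<in>UNIV. l $ i) = trace (transpose T ** (A ** T))"
      by (simp only: trace_diag_matrix[symmetric] l[symmetric] matrix_mul_assoc)
    also have "\<dots> = trace (A ** (T ** transpose T))"
      by (subst trace_matrix_mult_commute) (simp only: matrix_mul_assoc)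
    finally show ?thesis by (simp only: TS tr_inner_def)
  qed
  have sum_l2: "(\<Sum>i\<in>UNIV. (l $ i)\<^sup>2) \<le> K\<^sup>2"
  proof -
    have "(\<Sum>i\<in>UNIV. (l $ i)\<^sup>2) = trace (diag_matrix l ** diag_matrix l)"
      by (simp add: diag_matrix_mult trace_diag_matrix power2_eq_square)
    also have "\<dots> = trace (transpose T ** (A ** (T ** transpose T) ** A ** T))"
      by (simp only: l[symmetric] matrix_mul_assoc)
    also have "\<dots> = trace ((A ** \<Sigma>) ** (A ** \<Sigma>))"
      by (subst trace_matrix_mult_commute) (simp only: TS(3)[symmetric] matrix_mul_assoc)
    also have "\<dots> \<le> norm (A ** \<Sigma>) * norm (A ** \<Sigma>)"
      unfolding trace_mult_eq_inner using norm_cauchy_schwarz[of "transpose (A ** \<Sigma>)" "A ** \<Sigma>"]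
      by (simp add: norm_transpose)
    also have "\<dots> \<le> K * K"
      using \<Sigma> \<open>K \<ge> 0\<close> unfolding K_def
      by (intro mult_mono norm_matrix_mult_symmetric_le) (auto simp: pd_mats_def sym_mats_def)
    finally show ?thesis by (simp add: power2_eq_square)
  qed
  have l_le: "\<bar>s * l $ i\<bar> \<le> 1 / 4" for i
  proof -
    have "(l $ i)\<^sup>2 \<le> K\<^sup>2"
      using sum_l2 member_le_sum[of i UNIV "\<lambda>i. (l $ i)\<^sup>2"] by simp
    then have "\<bar>l $ i\<bar> \<le> K"
      using \<open>K \<ge> 0\<close> abs_le_square_iff[of "l $ i" K] by simp
    then have "\<bar>s\<bar> * \<bar>l $ i\<bar> \<le> \<bar>s\<bar> * K" by (intro mult_left_mono) auto
    then show ?thesis using s by (simp add: K_def abs_mult)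
  qed
  have "(\<integral>\<^sup>+\<omega>. ennreal (exp (s * (X \<omega> \<bullet> (A *v X \<omega>) - tr_inner A \<Sigma>))) \<partial>M) =
      (\<integral>\<^sup>+z. ennreal (std_normal_vec_density z) *
        ennreal (exp (s * ((T *v z) \<bullet> (A *v (T *v z)) - tr_inner A \<Sigma>))) \<partial>lborel)"
    by (rule nn_integral_centred_mvnormal[OF M X TS]) measurable
  also have "\<dots> = (\<integral>\<^sup>+z. (\<Prod>i\<in>UNIV. ennreal (std_normal_density (z $ i) *
      exp (s * l $ i * ((z $ i)\<^sup>2 - 1)))) \<partial>lborel)"
  proof (rule nn_integral_cong)
    fix z :: "real^'m"
    have "(T *v z) \<bullet> (A *v (T *v z)) - tr_inner A \<Sigma> = (\<Sum>i\<in>UNIV. l $ i * ((z $ i)\<^sup>2 - 1))"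
      by (simp add: inner_transpose_conjugate[symmetric] l inner_diag_matrix sum_l[symmetric]
          right_diff_distrib sum_subtractf)
    then have "exp (s * ((T *v z) \<bullet> (A *v (T *v z)) - tr_inner A \<Sigma>)) =
        (\<Prod>i\<in>UNIV. exp (s * l $ i * ((z $ i)\<^sup>2 - 1)))"
      by (simp add: exp_sum[symmetric] sum_distrib_left mult.assoc)
    then show "ennreal (std_normal_vec_density z) *
        ennreal (exp (s * ((T *v z) \<bullet> (A *v (T *v z)) - tr_inner A \<Sigma>))) =
      (\<Prod>i\<in>UNIV. ennreal (std_normal_density (z $ i) * exp (s * l $ i * ((z $ i)\<^sup>2 - 1))))"
      by (simp add: prod_ennreal prod.distrib std_normal_vec_density_def ennreal_mult' prod_nonneg)
  qed
  also have "\<dots> = (\<Prod>i\<in>UNIV. \<integral>\<^sup>+t. ennreal (std_normal_density t *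
      exp (s * l $ i * (t\<^sup>2 - 1))) \<partial>lborel)"
    by (rule nn_integral_lborel_vec_prod) measurable
  also have "\<dots> \<le> (\<Prod>i\<in>UNIV. ennreal (exp (2 * (s * l $ i)\<^sup>2)))"
    by (intro prod_mono_ennreal nn_integral_std_normal_exp_centred_square_le l_le)
  also have "\<dots> = ennreal (exp (2 * s\<^sup>2 * (\<Sum>i\<in>UNIV. (l $ i)\<^sup>2)))"
    by (simp add: prod_ennreal exp_sum[symmetric] sum_distrib_left power_mult_distrib mult.assoc)
  also have "\<dots> \<le> ennreal (exp (2 * s\<^sup>2 * K\<^sup>2))"
    using sum_l2 by (intro ennreal_leI) (simp add: mult_left_mono)
  finally show ?thesis by (simp add: K_def)
qed

section \<open>Concentration of the sample covariance matrix\<close>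

lemma tr_inner_eq_inner: "tr_inner A B = transpose A \<bullet> B"
  by (simp add: tr_inner_def trace_mult_eq_inner)

lemma tr_inner_commute: "tr_inner A B = tr_inner B A"
  by (simp add: tr_inner_def trace_matrix_mult_commute)

lemma tr_inner_scaleR_right: "tr_inner A (c *\<^sub>R B) = c * tr_inner A B"
  by (simp add: tr_inner_eq_inner)

lemma tr_inner_add_right: "tr_inner A (B + C) = tr_inner A B + tr_inner A C"
  by (simp add: tr_inner_eq_inner inner_add_right)

lemma tr_inner_diff_right: "tr_inner A (B - C) = tr_inner A B - tr_inner A C"
  by (simp add: tr_inner_eq_inner inner_diff_right)

lemma tr_inner_sum_right: "tr_inner A (\<Sum>i\<in>I. f i) = (\<Sum>i\<in>I. tr_inner A (f i))"
  by (simp add: tr_inner_eq_inner inner_sum_right)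

lemma tr_inner_scaleR_left: "tr_inner (c *\<^sub>R A) B = c * tr_inner A B"
  by (simp only: tr_inner_commute[of _ B] tr_inner_scaleR_right)

lemma tr_inner_add_left: "tr_inner (A + B) C = tr_inner A C + tr_inner B C"
  by (simp only: tr_inner_commute[of _ C] tr_inner_add_right)

lemma tr_inner_minus_left: "tr_inner (- A) B = - tr_inner A B"
  using tr_inner_scaleR_left[of "- 1" A B] by simp

lemma tr_inner_sum_left: "tr_inner (\<Sum>i\<in>I. f i) B = (\<Sum>i\<in>I. tr_inner (f i) B)"
  by (simp only: tr_inner_commute[of _ B] tr_inner_sum_right)

lemma tr_inner_sample_cov:
  fixes A :: "real^'m^'m"
  shows "tr_inner A (sample_cov n x) = (1 / real n) * (\<Sum>i=1..n. x i \<bullet> (A *v x i))"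
proof -
  have "tr_inner A (\<chi> j k. v $ j * v $ k) = v \<bullet> (A *v v)" for v :: "real^'m"
    unfolding tr_inner_def trace_def matrix_matrix_mult_def inner_vec_def matrix_vector_mult_def
    by (simp add: sum_distrib_left mult_ac)
  then show ?thesis
    by (simp add: sample_cov_def tr_inner_scaleR_right tr_inner_sum_right)
qed

text \<open>The Chernoff bound, before the exponent \<open>s\<close> is optimised.\<close>

lemma sample_cov_deviation_chernoff:
  fixes X :: "nat \<Rightarrow> 'a \<Rightarrow> real^'m" and A \<Sigma> :: "real^'m^'m"
  assumes M: "prob_space M" and n: "n \<ge> 1"
    and ind: "prob_space.indep_vars M (\<lambda>_. borel) X {1..n}"
    and X: "\<And>i. i \<in> {1..n} \<Longrightarrow> distributed M lborel (X i) (\<lambda>x. ennreal (mvnormal_density 0 \<Sigma> x))"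
    and \<Sigma>: "\<Sigma> \<in> pd_mats" and A: "A \<in> sym_mats"
    and s: "s > 0" "s * (op_norm \<Sigma> * norm A) \<le> 1 / 4"
  shows "measure M {\<omega> \<in> space M. tr_inner A (sample_cov n (\<lambda>i. X i \<omega>) - \<Sigma>) \<ge> t}
    \<le> exp (real n * (2 * s\<^sup>2 * (op_norm \<Sigma> * norm A)\<^sup>2 - s * t))"
proof -
  interpret prob_space M by fact
  define K where "K = op_norm \<Sigma> * norm A"
  define Y where "Y i \<omega> = X i \<omega> \<bullet> (A *v X i \<omega>) - tr_inner A \<Sigma>" for i \<omega>
  have X_meas [measurable]: "X i \<in> borel_measurable M" if "i \<in> {1..n}" for i
    using distributed_measurable[OF X[OF that]] by simp
  have Y_meas [measurable]: "Y i \<in> borel_measurable M" if "i \<in> {1..n}" for i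
    unfolding Y_def[abs_def] using that by measurable
  have dev: "real n * tr_inner A (sample_cov n (\<lambda>i. X i \<omega>) - \<Sigma>) = (\<Sum>i=1..n. Y i \<omega>)" for \<omega>
    using n by (simp add: tr_inner_diff_right tr_inner_sample_cov Y_def sum_subtractf algebra_simps)
  have "t \<le> x \<longleftrightarrow> real n * t \<le> real n * x" for x
    using n by simp
  then have "{\<omega> \<in> space M. tr_inner A (sample_cov n (\<lambda>i. X i \<omega>) - \<Sigma>) \<ge> t} =
      {\<omega> \<in> space M. (\<Sum>i=1..n. Y i \<omega>) \<ge> real n * t}"
    by (simp only: dev)
  then have "emeasure M {\<omega> \<in> space M. tr_inner A (sample_cov n (\<lambda>i. X i \<omega>) - \<Sigma>) \<ge> t} \<le>
      ennreal (exp (- s * (real n * t))) * (\<integral>\<^sup>+\<omega>\<in>space M. ennreal (exp (s * (\<Sum>i=1..n. Y i \<omega>))) \<partial>M)"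
    using Chernoff_ineq_nn_integral_ge[of s "space M" M "\<lambda>\<omega>. \<Sum>i=1..n. Y i \<omega>" "real n * t"] s(1)
    by simp
  also have "(\<integral>\<^sup>+\<omega>\<in>space M. ennreal (exp (s * (\<Sum>i=1..n. Y i \<omega>))) \<partial>M) =
      (\<integral>\<^sup>+\<omega>. (\<Prod>i=1..n. ennreal (exp (s * Y i \<omega>))) \<partial>M)"
    by (intro nn_integral_cong) (simp add: sum_distrib_left exp_sum prod_ennreal)
  also have "\<dots> = (\<Prod>i=1..n. \<integral>\<^sup>+\<omega>. ennreal (exp (s * Y i \<omega>)) \<partial>M)"
    unfolding Y_def by (intro indep_vars_nn_integral indep_vars_compose2[OF ind]) auto
  also have "\<dots> \<le> (\<Prod>i=1..n. ennreal (exp (2 * s\<^sup>2 * K\<^sup>2)))"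
    unfolding Y_def K_def using s
    by (intro prod_mono_ennreal mvnormal_quadratic_form_mgf_le[OF M X \<Sigma> A]) auto
  also have "\<dots> = ennreal (exp (real n * (2 * s\<^sup>2 * K\<^sup>2)))"
    by (simp add: ennreal_power exp_of_nat_mult)
  finally have "emeasure M {\<omega> \<in> space M. tr_inner A (sample_cov n (\<lambda>i. X i \<omega>) - \<Sigma>) \<ge> t} \<le>
      ennreal (exp (- s * (real n * t))) * ennreal (exp (real n * (2 * s\<^sup>2 * K\<^sup>2)))"
    by (simp add: mult_left_mono)
  also have "\<dots> = ennreal (exp (real n * (2 * s\<^sup>2 * K\<^sup>2 - s * t)))"
    by (simp add: ennreal_mult[symmetric] exp_add[symmetric] algebra_simps)
  finally show ?thesis
    by (simp add: emeasure_eq_measure K_def)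
qed

text \<open>
  The exponent \<open>s = t / (4 K\<^sup>2)\<close> is optimal but admissible only for \<open>t \<le> K\<close>; for larger \<open>t\<close> the
  largest admissible exponent \<open>1 / (4 K)\<close> is taken.
\<close>

lemma sample_cov_deviation_upper_tail:
  fixes X :: "nat \<Rightarrow> 'a \<Rightarrow> real^'m" and A \<Sigma> :: "real^'m^'m"
  assumes M: "prob_space M" and n: "n \<ge> 1"
    and ind: "prob_space.indep_vars M (\<lambda>_. borel) X {1..n}"
    and X: "\<And>i. i \<in> {1..n} \<Longrightarrow> distributed M lborel (X i) (\<lambda>x. ennreal (mvnormal_density 0 \<Sigma> x))"
    and \<Sigma>: "\<Sigma> \<in> pd_mats" and A: "A \<in> sym_mats"
    and K: "K = op_norm \<Sigma> * norm A" "K > 0" and t: "t > 0"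
  shows "measure M {\<omega> \<in> space M. tr_inner A (sample_cov n (\<lambda>i. X i \<omega>) - \<Sigma>) \<ge> t}
    \<le> (if t \<le> K then exp (- (real n * t\<^sup>2 / (8 * K\<^sup>2))) else exp (- (real n * t / (8 * K))))"
proof (cases "t \<le> K")
  case True
  define s where "s = t / (4 * K\<^sup>2)"
  have "s > 0" using K(2) t by (simp add: s_def)
  moreover have "s * K \<le> 1 / 4" using True K(2) by (simp add: s_def power2_eq_square divide_simps)
  ultimately have "measure M {\<omega> \<in> space M. tr_inner A (sample_cov n (\<lambda>i. X i \<omega>) - \<Sigma>) \<ge> t}
      \<le> exp (real n * (2 * s\<^sup>2 * K\<^sup>2 - s * t))"
    unfolding K(1) by (intro sample_cov_deviation_chernoff[OF M n ind X \<Sigma> A])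
  also have "2 * s\<^sup>2 * K\<^sup>2 - s * t = - (t\<^sup>2 / (8 * K\<^sup>2))"
    using K(2) by (simp add: s_def field_simps power2_eq_square)
  finally show ?thesis using True by simp
next
  case False
  define s where "s = 1 / (4 * K)"
  have "s > 0" using K(2) t by (simp add: s_def)
  moreover have "s * K \<le> 1 / 4" using K(2) by (simp add: s_def)
  ultimately have "measure M {\<omega> \<in> space M. tr_inner A (sample_cov n (\<lambda>i. X i \<omega>) - \<Sigma>) \<ge> t}
      \<le> exp (real n * (2 * s\<^sup>2 * K\<^sup>2 - s * t))"
    unfolding K(1) by (intro sample_cov_deviation_chernoff[OF M n ind X \<Sigma> A])
  also have "\<dots> \<le> exp (real n * (- (t / (8 * K))))"
  proof -
    have "2 * s\<^sup>2 * K\<^sup>2 - s * t = 1 / 8 - t / (4 * K)"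
      using K(2) by (simp add: s_def field_simps power2_eq_square)
    also have "\<dots> \<le> - (t / (8 * K))"
      using False K(2) by (simp add: field_simps)
    finally show ?thesis by (intro exp_le_cancel_iff[THEN iffD2] mult_left_mono) auto
  qed
  finally show ?thesis using False by simp
qed

lemma sample_cov_deviation_two_sided_tail:
  fixes X :: "nat \<Rightarrow> 'a \<Rightarrow> real^'m" and A \<Sigma> :: "real^'m^'m"
  assumes M: "prob_space M" and n: "n \<ge> 1"
    and ind: "prob_space.indep_vars M (\<lambda>_. borel) X {1..n}"
    and X: "\<And>i. i \<in> {1..n} \<Longrightarrow> distributed M lborel (X i) (\<lambda>x. ennreal (mvnormal_density 0 \<Sigma> x))"
    and \<Sigma>: "\<Sigma> \<in> pd_mats" and A: "A \<in> sym_mats"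
    and K: "K = op_norm \<Sigma> * norm A" "K > 0" and t: "t > 0"
  shows "measure M {\<omega> \<in> space M. \<bar>tr_inner A (sample_cov n (\<lambda>i. X i \<omega>) - \<Sigma>)\<bar> \<ge> t}
    \<le> 2 * (if t \<le> K then exp (- (real n * t\<^sup>2 / (8 * K\<^sup>2))) else exp (- (real n * t / (8 * K))))"
    (is "_ \<le> 2 * ?b")
    and "{\<omega> \<in> space M. \<bar>tr_inner A (sample_cov n (\<lambda>i. X i \<omega>) - \<Sigma>)\<bar> \<ge> t} \<in> sets M"
proof -
  interpret prob_space M by fact
  have [measurable]: "X i \<in> borel_measurable M" if "i \<in> {1..n}" for i
    using distributed_measurable[OF X[OF that]] by simp
  let ?D = "\<lambda>B \<omega>. tr_inner B (sample_cov n (\<lambda>i. X i \<omega>) - \<Sigma>)"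
  have [measurable]: "?D B \<in> borel_measurable M" for B
    unfolding tr_inner_diff_right tr_inner_sample_cov by measurable
  show "{\<omega> \<in> space M. \<bar>?D A \<omega>\<bar> \<ge> t} \<in> sets M" by measurable
  have "- A \<in> sym_mats"
    using A by (simp add: sym_mats_def transpose_def vec_eq_iff)
  then have lower: "measure M {\<omega> \<in> space M. ?D (- A) \<omega> \<ge> t} \<le> ?b"
    using K by (intro sample_cov_deviation_upper_tail[OF M n ind X \<Sigma> _ _ _ t]) auto
  have "measure M {\<omega> \<in> space M. \<bar>?D A \<omega>\<bar> \<ge> t} \<le>
      measure M ({\<omega> \<in> space M. ?D A \<omega> \<ge> t} \<union> {\<omega> \<in> space M. ?D (- A) \<omega> \<ge> t})"
    by (intro finite_measure_mono) (auto simp: tr_inner_minus_left)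
  also have "\<dots> \<le> measure M {\<omega> \<in> space M. ?D A \<omega> \<ge> t} + measure M {\<omega> \<in> space M. ?D (- A) \<omega> \<ge> t}"
    by (intro measure_Un_le) measurable
  also have "\<dots> \<le> ?b + ?b"
    by (intro add_mono lower sample_cov_deviation_upper_tail[OF M n ind X \<Sigma> A K t])
  finally show "measure M {\<omega> \<in> space M. \<bar>?D A \<omega>\<bar> \<ge> t} \<le> 2 * ?b" by simp
qed

section \<open>Convex duality and the Bregman loss\<close>

lemma lin_param_add: "lin_param A (\<theta> + \<omega>) = lin_param A \<theta> + lin_param A \<omega>"
  by (simp add: lin_param_def scaleR_left_distrib sum.distrib)

lemma lin_param_scaleR: "lin_param A (c *\<^sub>R \<theta>) = c *\<^sub>R lin_param A \<theta>"
  by (simp add: lin_param_def scaleR_sum_right)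

lemma bregman_class_finite:
  assumes F: "F \<in> bregman_class" and \<Sigma>: "\<Sigma> \<in> pd_mats"
  obtains a where "F \<Sigma> = ereal a"
proof -
  have "\<Sigma> \<in> sym_mats" "F \<Sigma> < \<infinity>" "F \<Sigma> \<noteq> - \<infinity>"
    using F \<Sigma> by (auto simp: bregman_class_def pd_mats_def)
  then show ?thesis using that by (cases "F \<Sigma>") auto
qed

text \<open>
  The gradient is a subgradient on all symmetric matrices, also where \<open>F\<close> is infinite or not
  differentiable. Only the directional derivative at \<open>\<Sigma>\<close> along the segment to \<open>Y\<close> enters.
\<close>

lemma bregman_class_gradient_inequality:
  assumes F: "F \<in> bregman_class" and \<Sigma>: "\<Sigma> \<in> pd_mats" and Y: "Y \<in> sym_mats"
  shows "F \<Sigma> + ereal (tr_inner (sym_gradient F \<Sigma>) (Y - \<Sigma>)) \<le> F Y"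
proof (cases "F Y")
  case PInf
  then show ?thesis by simp
next
  case MInf
  then show ?thesis using F Y by (simp add: bregman_class_def)
next
  case (real y)
  obtain a where a: "F \<Sigma> = ereal a" using bregman_class_finite[OF F \<Sigma>] .
  have \<Sigma>s: "\<Sigma> \<in> sym_mats" using \<Sigma> by (simp add: pd_mats_def)
  obtain G where "has_sym_gradient F G \<Sigma>" using F \<Sigma> by (auto simp: bregman_class_def)
  then have G: "has_sym_gradient F (sym_gradient F \<Sigma>) \<Sigma>" using sym_gradient_eqI[OF \<Sigma>s] by simp
  define H where "H = Y - \<Sigma>"
  define D where "D = tr_inner (sym_gradient F \<Sigma>) H"
  define p where "p t = \<Sigma> + t *\<^sub>R H" for t :: real
  have line: "range p \<subseteq> sym_mats"
    using \<Sigma>s Y unfolding p_def H_def sym_mats_def transpose_def by (auto simp: vec_eq_iff)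
  have "(p has_derivative (\<lambda>t. t *\<^sub>R H)) (at 0)"
    unfolding p_def[abs_def] by (auto intro!: derivative_eq_intros)
  moreover have "((\<lambda>Y. real_of_ereal (F Y)) has_derivative tr_inner (sym_gradient F \<Sigma>))
      (at (p 0) within range p)"
  proof -
    have "p 0 = \<Sigma>" by (simp add: p_def)
    moreover have "((\<lambda>Y. real_of_ereal (F Y)) has_derivative tr_inner (sym_gradient F \<Sigma>))
        (at \<Sigma> within sym_mats)"
      using G by (simp add: has_sym_gradient_def)
    ultimately show ?thesis using has_derivative_subset[OF _ line] by metis
  qed
  ultimately have "((\<lambda>t. real_of_ereal (F (p t))) has_derivative
      (\<lambda>t. tr_inner (sym_gradient F \<Sigma>) (t *\<^sub>R H))) (at 0)"
    by (rule has_derivative_in_compose)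
  then have "((\<lambda>t. real_of_ereal (F (p t))) has_real_derivative D) (at 0)"
  proof -
    have "(\<lambda>t. tr_inner (sym_gradient F \<Sigma>) (t *\<^sub>R H)) = (*) D"
      by (simp add: fun_eq_iff tr_inner_scaleR_right D_def)
    with \<open>((\<lambda>t. real_of_ereal (F (p t))) has_derivative _) (at 0)\<close> show ?thesis
      by (simp add: has_field_derivative_def)
  qed
  then have "((\<lambda>t. (real_of_ereal (F (p t)) - a) / t) \<longlongrightarrow> D) (at 0)"
    by (simp add: DERIV_def p_def a)
  then have lim: "((\<lambda>t. (real_of_ereal (F (p t)) - a) / t) \<longlongrightarrow> D) (at_right 0)"
    by (rule tendsto_within_subset) simp
  have quot: "(real_of_ereal (F (p t)) - a) / t \<le> y - a" if "0 < t" "t < 1" for t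
  proof -
    have pt: "p t = (1 - t) *\<^sub>R \<Sigma> + t *\<^sub>R Y"
      by (simp add: p_def H_def algebra_simps)
    have "ereal_convex_on sym_mats F" using F by (simp add: bregman_class_def)
    then have "\<forall>u\<ge>0. \<forall>v\<ge>0. u + v = 1 \<longrightarrow>
        F (u *\<^sub>R \<Sigma> + v *\<^sub>R Y) \<le> ereal u * F \<Sigma> + ereal v * F Y"
      using \<Sigma>s Y unfolding ereal_convex_on_def by blast
    from this[rule_format, of "1 - t" t] have "F (p t) \<le> ereal ((1 - t) * a + t * y)"
      using that by (simp add: pt a real)
    moreover have "F (p t) \<noteq> - \<infinity>"
      using F line by (auto simp: bregman_class_def)
    ultimately have "real_of_ereal (F (p t)) \<le> (1 - t) * a + t * y"
      by (cases "F (p t)") auto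
    then have "real_of_ereal (F (p t)) - a \<le> t * (y - a)" by (simp add: algebra_simps)
    then show ?thesis using that by (simp add: pos_divide_le_eq mult.commute)
  qed
  have "D \<le> y - a"
  proof (rule tendsto_upperbound[OF lim])
    have "\<forall>\<^sub>F t :: real in at_right 0. t < 1"
      unfolding eventually_at_right_field by (intro exI[of _ 1]) simp
    with eventually_at_right_less[of "0::real"]
    show "\<forall>\<^sub>F t in at_right 0. (real_of_ereal (F (p t)) - a) / t \<le> y - a"
      by eventually_elim (rule quot)
  qed simp
  then show ?thesis by (simp add: a real D_def H_def)
qed

lemma sym_conjugate_ge:
  "X \<in> sym_mats \<Longrightarrow> F X = ereal a \<Longrightarrow> ereal (tr_inner X L - a) \<le> sym_conjugate F L"
  unfolding sym_conjugate_def by (intro SUP_upper2[of X]) auto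

text \<open>The equality case of the Fenchel--Young inequality.\<close>

lemma sym_conjugate_sym_gradient:
  assumes F: "F \<in> bregman_class" and \<Sigma>: "\<Sigma> \<in> pd_mats" and a: "F \<Sigma> = ereal a"
  shows "sym_conjugate F (sym_gradient F \<Sigma>) = ereal (tr_inner \<Sigma> (sym_gradient F \<Sigma>) - a)"
proof (rule antisym)
  let ?G = "sym_gradient F \<Sigma>"
  show "sym_conjugate F ?G \<le> ereal (tr_inner \<Sigma> ?G - a)"
    unfolding sym_conjugate_def
  proof (rule SUP_least)
    fix Y :: "real^'a^'a" assume Y: "Y \<in> sym_mats"
    show "ereal (tr_inner Y ?G) - F Y \<le> ereal (tr_inner \<Sigma> ?G - a)"
      using bregman_class_gradient_inequality[OF F \<Sigma> Y] a
      by (cases "F Y") (auto simp: tr_inner_diff_right tr_inner_commute[of ?G])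
  qed
  show "ereal (tr_inner \<Sigma> ?G - a) \<le> sym_conjugate F ?G"
    using \<Sigma> a by (intro sym_conjugate_ge) (auto simp: pd_mats_def)
qed

lemma sym_conjugate_convex_bound:
  assumes F: "F \<in> bregman_class"
    and L: "sym_conjugate F L1 \<le> ereal c" "sym_conjugate F L2 \<le> ereal d"
    and uv: "u \<ge> 0" "v \<ge> 0" "u + v = 1"
  shows "sym_conjugate F (u *\<^sub>R L1 + v *\<^sub>R L2) \<le> ereal (u * c + v * d)"
  unfolding sym_conjugate_def
proof (rule SUP_least)
  fix X :: "real^'a^'a" assume X: "X \<in> sym_mats"
  show "ereal (tr_inner X (u *\<^sub>R L1 + v *\<^sub>R L2)) - F X \<le> ereal (u * c + v * d)"
  proof (cases "F X")
    case PInf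
    then show ?thesis by simp
  next
    case MInf
    then show ?thesis using F X by (simp add: bregman_class_def)
  next
    case (real x)
    have "tr_inner X L1 - x \<le> c" "tr_inner X L2 - x \<le> d"
      using order_trans[OF sym_conjugate_ge[where F = F and a = x, OF X real] L(1)]
        order_trans[OF sym_conjugate_ge[where F = F and a = x, OF X real] L(2)] by auto
    then have "u * (tr_inner X L1 - x) + v * (tr_inner X L2 - x) \<le> u * c + v * d"
      using uv by (intro add_mono mult_left_mono)
    moreover have "u * x + v * x = x"
      using uv(3) by (simp add: distrib_right[symmetric])
    ultimately show ?thesis
      by (simp add: real tr_inner_add_right tr_inner_scaleR_right algebra_simps)
  qed
qed

text \<open>The population loss is minimised, with value \<open>- F \<Sigma>\<close>, at the true parameter.\<close>

lemma population_loss_at_truth: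
  assumes F: "F \<in> bregman_class" and \<Sigma>: "\<Sigma> \<in> pd_mats" and a: "F \<Sigma> = ereal a"
    and \<theta>0: "lin_param A \<theta>0 = sym_gradient F \<Sigma>"
  shows "bregman_loss F A \<Sigma> \<theta>0 = ereal (- a)"
  using sym_conjugate_sym_gradient[OF F \<Sigma> a]
  by (simp add: bregman_loss_def \<theta>0 tr_inner_commute[of \<Sigma>])

lemma population_loss_ge:
  assumes "\<Sigma> \<in> pd_mats" and "F \<Sigma> = ereal a"
  shows "bregman_loss F A \<Sigma> \<theta> \<ge> ereal (- a)"
proof -
  have "ereal (tr_inner \<Sigma> (lin_param A \<theta>) - a) \<le> sym_conjugate F (lin_param A \<theta>)"
    using assms by (intro sym_conjugate_ge) (auto simp: pd_mats_def)
  then show ?thesis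
    by (cases "sym_conjugate F (lin_param A \<theta>)")
      (auto simp: bregman_loss_def tr_inner_commute[of \<Sigma>])
qed

text \<open>
  Strong convexity at a minimiser gives quadratic growth. The function need not be
  differentiable: comparing with the points \<open>t \<omega>\<close> and letting \<open>t\<close> tend to \<open>0\<close> replaces the
  first-order condition.
\<close>

lemma strongly_convex_in_ball_quadratic_growth:
  assumes f0: "f 0 = 0" and nonneg: "\<And>\<omega>. f \<omega> \<ge> 0"
    and sc: "strongly_convex_in_ball \<mu> \<epsilon> f" and \<omega>: "norm \<omega> \<le> \<epsilon>"
  shows "ereal (\<mu> / 2 * (norm \<omega>)\<^sup>2) \<le> f \<omega>"
proof (cases "f \<omega>")
  case (real e)
  define D where "D = \<mu> / 2 * (norm \<omega>)\<^sup>2"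
  have "\<epsilon> \<ge> 0" using \<omega> norm_ge_zero order_trans by blast
  let ?g = "\<lambda>\<omega>. f \<omega> - ereal (\<mu> / 2 * (norm \<omega>)\<^sup>2)"
  have cvx: "\<forall>u\<ge>0. \<forall>v\<ge>0. u + v = 1 \<longrightarrow>
      ?g (u *\<^sub>R 0 + v *\<^sub>R \<omega>) \<le> ereal u * ?g 0 + ereal v * ?g \<omega>"
  proof -
    have "0 \<in> {\<omega>. norm \<omega> \<le> \<epsilon>}" "\<omega> \<in> {\<omega>. norm \<omega> \<le> \<epsilon>}"
      using \<omega> \<open>\<epsilon> \<ge> 0\<close> by auto
    with sc show ?thesis
      unfolding strongly_convex_in_ball_def ereal_convex_on_def by blast
  qed
  have "D \<le> e"
  proof (rule field_le_mult_one_interval)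
    fix z :: real assume z: "0 < z" "z < 1"
    define t where "t = 1 - z"
    have t: "0 < t" "t < 1" using z by (auto simp: t_def)
    have "?g (t *\<^sub>R \<omega>) \<le> ereal (t * (e - D))"
      using cvx[rule_format, of z t] z t by (simp add: t_def f0 real D_def)
    moreover have "ereal (- (t\<^sup>2 * D)) \<le> ?g (t *\<^sub>R \<omega>)"
      using nonneg[of "t *\<^sub>R \<omega>"]
      by (cases "f (t *\<^sub>R \<omega>)") (auto simp: D_def power_mult_distrib mult.left_commute)
    ultimately have "ereal (- (t\<^sup>2 * D)) \<le> ereal (t * (e - D))" by (rule order_trans[rotated])
    then have "t * (- (t * D)) \<le> t * (e - D)" by (simp add: power2_eq_square)
    then have "- (t * D) \<le> e - D" using t by (simp only: mult_le_cancel_left_pos)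
    then show "z * D \<le> e" by (simp add: t_def algebra_simps)
  qed
  then show ?thesis by (simp add: real D_def)
qed (use nonneg[of \<omega>] in auto)

text \<open>
  If the estimate leaves the \<open>\<epsilon>\<close>-ball then, by convexity, the empirical loss is at most its
  value at \<open>\<theta>\<^sub>0\<close> also where the segment to the estimate crosses the sphere. There the
  sampling error has to compensate for the quadratic growth of the population loss.
\<close>

lemma bregman_estimate_outside_ball:
  assumes F: "F \<in> bregman_class" and \<Sigma>: "\<Sigma> \<in> pd_mats"
    and \<theta>0: "lin_param A \<theta>0 = sym_gradient F \<Sigma>"
    and est: "is_bregman_estimate F A S \<theta>"
    and sc: "strongly_convex_in_ball \<mu> \<epsilon> (excess_loss F A \<Sigma> \<theta>0)"
    and \<epsilon>: "0 < \<epsilon>" "\<epsilon> < norm (\<theta> - \<theta>0)"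
  obtains \<omega> where "norm \<omega> = \<epsilon>" "\<mu> / 2 * \<epsilon>\<^sup>2 \<le> tr_inner (lin_param A \<omega>) (S - \<Sigma>)"
proof -
  obtain a where a: "F \<Sigma> = ereal a" using bregman_class_finite[OF F \<Sigma>] .
  let ?L = "lin_param A"
  let ?G = "sym_gradient F \<Sigma>"
  let ?E = "excess_loss F A \<Sigma> \<theta>0"
  \<comment> \<open>The excess loss vanishes at \<open>0\<close> and is nonnegative, so it grows quadratically in the ball.\<close>
  note loss0 = population_loss_at_truth[OF F \<Sigma> a \<theta>0]
  have "?E 0 = 0"
    by (simp add: excess_loss_def loss0)
  moreover have "?E \<omega> \<ge> 0" for \<omega>
    using population_loss_ge[where F = F and a = a and A = A and \<theta> = "\<theta>0 + \<omega>", OF \<Sigma> a]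
    by (cases "bregman_loss F A \<Sigma> (\<theta>0 + \<omega>)") (auto simp: excess_loss_def loss0)
  ultimately have growth: "ereal (\<mu> / 2 * (norm \<omega>)\<^sup>2) \<le> ?E \<omega>" if "norm \<omega> \<le> \<epsilon>" for \<omega>
    using strongly_convex_in_ball_quadratic_growth[OF _ _ sc that] by blast
  define \<eta> where "\<eta> = \<theta> - \<theta>0"
  define t where "t = \<epsilon> / norm \<eta>"
  have t: "0 \<le> t" "t \<le> 1" using \<epsilon> by (auto simp: t_def \<eta>_def divide_simps)
  define \<omega> where "\<omega> = t *\<^sub>R \<eta>"
  have norm_\<omega>: "norm \<omega> = \<epsilon>" using \<epsilon> by (auto simp: \<omega>_def t_def \<eta>_def)
  define c where "c = tr_inner \<Sigma> ?G - a"
  have conj0: "sym_conjugate F ?G = ereal c"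
    unfolding c_def by (rule sym_conjugate_sym_gradient[OF F \<Sigma> a])
  have L\<theta>: "?L \<theta> = ?G + ?L \<eta>"
    using lin_param_add[of A \<theta>0 \<eta>] by (simp add: \<eta>_def \<theta>0)
  \<comment> \<open>Optimality of the estimate makes the conjugate finite at the estimate, as convexity requires.\<close>
  have conj1: "sym_conjugate F (?L \<theta>) \<le> ereal (c + tr_inner (?L \<eta>) S)"
  proof -
    have "\<theta>0 \<in> param_domain F A"
      using \<theta>0 \<Sigma> by (simp add: param_domain_def gradient_domain_def)
    then have "bregman_loss F A S \<theta> \<le> bregman_loss F A S \<theta>0"
      using est by (simp add: is_bregman_estimate_def)
    then show ?thesis
      by (cases "sym_conjugate F (?L \<theta>)")
        (auto simp: bregman_loss_def \<theta>0 conj0 L\<theta> tr_inner_add_left)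
  qed
  have "?L (\<theta>0 + \<omega>) = (1 - t) *\<^sub>R ?G + t *\<^sub>R ?L \<theta>"
    by (simp add: lin_param_add \<theta>0 L\<theta> \<omega>_def lin_param_scaleR algebra_simps)
  moreover have "sym_conjugate F ((1 - t) *\<^sub>R ?G + t *\<^sub>R ?L \<theta>) \<le>
      ereal ((1 - t) * c + t * (c + tr_inner (?L \<eta>) S))"
    using t conj0 conj1 by (intro sym_conjugate_convex_bound[OF F]) auto
  moreover have "(1 - t) * c + t * (c + tr_inner (?L \<eta>) S) = c + tr_inner (?L \<omega>) S"
    by (simp add: \<omega>_def lin_param_scaleR tr_inner_scaleR_left algebra_simps)
  ultimately have conj\<omega>: "sym_conjugate F (?L (\<theta>0 + \<omega>)) \<le> ereal (c + tr_inner (?L \<omega>) S)"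
    by (simp only:)
  have "?E \<omega> = bregman_loss F A \<Sigma> (\<theta>0 + \<omega>) - ereal (- a)"
    by (simp only: excess_loss_def loss0)
  then have "?E \<omega> \<le> ereal (tr_inner (?L \<omega>) (S - \<Sigma>))"
    using conj\<omega>
    by (cases "sym_conjugate F (?L (\<theta>0 + \<omega>))")
      (auto simp: bregman_loss_def lin_param_add[of A \<theta>0 \<omega>] \<theta>0 c_def
        tr_inner_add_left tr_inner_diff_right tr_inner_commute[of \<Sigma>])
  with growth[of \<omega>] have "ereal (\<mu> / 2 * \<epsilon>\<^sup>2) \<le> ereal (tr_inner (?L \<omega>) (S - \<Sigma>))"
    unfolding norm_\<omega> using order_trans by blast
  with norm_\<omega> that show ?thesis by simp
qed

text \<open>
  In terms of the coordinates of the sampling error in the basis \<open>A\<close>: by Cauchy--Schwarz its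
  Euclidean norm is at least \<open>\<mu> \<epsilon> / 2\<close>, so some coordinate is at least \<open>\<mu> \<epsilon> / (2 \<surd>d)\<close>.
\<close>

lemma bregman_estimate_outside_ball_coordinate:
  fixes A :: "'d::finite \<Rightarrow> real^'m^'m"
  assumes F: "F \<in> bregman_class" and \<Sigma>: "\<Sigma> \<in> pd_mats"
    and \<theta>0: "lin_param A \<theta>0 = sym_gradient F \<Sigma>"
    and est: "is_bregman_estimate F A S \<theta>"
    and sc: "strongly_convex_in_ball \<mu> \<epsilon> (excess_loss F A \<Sigma> \<theta>0)"
    and \<epsilon>: "0 < \<epsilon>" "\<epsilon> < norm (\<theta> - \<theta>0)" and \<mu>: "0 < \<mu>"
  shows "\<exists>i. \<bar>tr_inner (A i) (S - \<Sigma>)\<bar> \<ge> \<mu> * \<epsilon> / (2 * sqrt (real CARD('d)))"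
proof (rule ccontr)
  define \<tau> where "\<tau> = \<mu> * \<epsilon> / (2 * sqrt (real CARD('d)))"
  assume "\<not> ?thesis"
  then have small: "\<bar>tr_inner (A i) (S - \<Sigma>)\<bar> < \<tau>" for i by (simp add: \<tau>_def not_le)
  obtain \<omega> where \<omega>: "norm \<omega> = \<epsilon>" "\<mu> / 2 * \<epsilon>\<^sup>2 \<le> tr_inner (lin_param A \<omega>) (S - \<Sigma>)"
    using bregman_estimate_outside_ball[OF F \<Sigma> \<theta>0 est sc \<epsilon>] .
  define v :: "real^'d" where "v = (\<chi> i. tr_inner (A i) (S - \<Sigma>))"
  have "\<tau> > 0" using \<mu> \<epsilon> by (simp add: \<tau>_def)
  have "norm v < sqrt (real CARD('d)) * \<tau>"
  proof -
    have "(\<Sum>i\<in>UNIV. (v $ i)\<^sup>2) < (\<Sum>i\<in>(UNIV::'d set). \<tau>\<^sup>2)"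
    proof (intro sum_strict_mono)
      show "(v $ i)\<^sup>2 < \<tau>\<^sup>2" for i
        using small[of i] \<open>\<tau> > 0\<close> abs_le_square_iff[of \<tau> "v $ i"] by (simp add: v_def not_le[symmetric])
    qed auto
    then have "sqrt (\<Sum>i\<in>UNIV. (v $ i)\<^sup>2) < sqrt (real CARD('d) * \<tau>\<^sup>2)" by simp
    then show ?thesis
      using \<open>\<tau> > 0\<close> by (simp add: norm_vec_def L2_set_def real_sqrt_mult)
  qed
  then have "\<epsilon> * norm v < \<epsilon> * (sqrt (real CARD('d)) * \<tau>)" using \<epsilon>(1) by simp
  also have "\<dots> = \<mu> / 2 * \<epsilon>\<^sup>2" by (simp add: \<tau>_def power2_eq_square)
  also have "\<dots> \<le> tr_inner (lin_param A \<omega>) (S - \<Sigma>)" by (rule \<omega>)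
  also have "\<dots> = \<omega> \<bullet> v"
    by (simp add: lin_param_def tr_inner_sum_left tr_inner_scaleR_left inner_vec_def v_def)
  also have "\<dots> \<le> \<epsilon> * norm v"
    using norm_cauchy_schwarz[of \<omega> v] \<omega>(1) by simp
  finally show False by simp
qed

section \<open>Deviation of the Bregman estimate\<close>

lemma op_norm_pos:
  assumes "\<Sigma> \<in> pd_mats"
  shows "0 < op_norm (\<Sigma> :: real^'m^'m)"
proof -
  obtain i :: 'm where True by blast
  let ?e = "axis i 1 :: real^'m"
  have "?e \<noteq> 0" by (simp add: axis_eq_0_iff)
  then have "0 < ?e \<bullet> (\<Sigma> *v ?e)" using assms by (simp add: pd_mats_def)
  then have "\<Sigma> *v ?e \<noteq> 0" by auto
  then have "\<not> (\<forall>x. \<Sigma> *v x = 0)" by blast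
  then show ?thesis
    unfolding op_norm_def by (simp add: onorm_pos_lt[OF matrix_vector_mul_bounded_linear])
qed

lemma tr_orthonormal_basis_sym_mats:
  assumes "tr_orthonormal_basis A V" "V \<subseteq> sym_mats"
  shows "A i \<in> sym_mats" "norm (A i) = 1"
proof -
  have "A i \<in> span (range A)" by (simp add: span_base)
  then show sym: "A i \<in> sym_mats" using assms by (auto simp: tr_orthonormal_basis_def)
  have "tr_inner (A i) (A i) = 1" using assms(1) by (simp add: tr_orthonormal_basis_def)
  then show "norm (A i) = 1" using sym by (simp add: tr_inner_eq_inner sym_mats_def norm_eq_1)
qed

text \<open>
  The union bound over the coordinates of the sampling error. Each \<open>A i\<close> has Frobenius norm
  \<open>1\<close>, so the tail bounds hold with the spectral norm of \<open>\<Sigma>\<close> as scale.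
\<close>

lemma bregman_estimate_deviation:
  fixes A :: "'d::finite \<Rightarrow> real^'m^'m" and X :: "nat \<Rightarrow> 'a \<Rightarrow> real^'m"
    and \<theta>hat :: "'a \<Rightarrow> real^'d"
  assumes F: "F \<in> bregman_class" and V: "V \<subseteq> sym_mats" and A: "tr_orthonormal_basis A V"
    and \<Sigma>: "\<Sigma> \<in> pd_mats" and \<theta>0: "lin_param A \<theta>0 = sym_gradient F \<Sigma>"
    and M: "prob_space M" and n: "n \<ge> 1"
    and ind: "prob_space.indep_vars M (\<lambda>_. borel) X {1..n}"
    and X: "\<And>i. i \<in> {1..n} \<Longrightarrow> distributed M lborel (X i) (\<lambda>x. ennreal (mvnormal_density 0 \<Sigma> x))"
    and est: "AE s in M. is_bregman_estimate F A (sample_cov n (\<lambda>i. X i s)) (\<theta>hat s)"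
    and pos: "0 < \<epsilon>" "0 < \<mu>"
    and sc: "strongly_convex_in_ball \<mu> \<epsilon> (excess_loss F A \<Sigma> \<theta>0)"
  shows "measure M {s \<in> space M. norm (\<theta>hat s - \<theta>0) > \<epsilon>} \<le>
    (if \<epsilon> \<le> 2 * op_norm \<Sigma> * sqrt (real CARD('d)) / \<mu>
     then 2 * real CARD('d) *
       exp (- (\<mu>\<^sup>2 * \<epsilon>\<^sup>2 * real n / (32 * real CARD('d) * (op_norm \<Sigma>)\<^sup>2)))
     else 2 * real CARD('d) *
       exp (- (\<mu> * \<epsilon> * real n / (16 * sqrt (real CARD('d)) * op_norm \<Sigma>))))"
proof -
  interpret prob_space M by fact
  define d where "d = real CARD('d)"
  have d: "d > 0" by (simp add: d_def)
  define K where "K = op_norm \<Sigma>"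
  have K: "K > 0" by (simp add: K_def op_norm_pos[OF \<Sigma>])
  define \<tau> where "\<tau> = \<mu> * \<epsilon> / (2 * sqrt d)"
  have \<tau>: "\<tau> > 0" using pos d by (simp add: \<tau>_def)
  define b where "b = (if \<tau> \<le> K then exp (- (real n * \<tau>\<^sup>2 / (8 * K\<^sup>2))) else exp (- (real n * \<tau> / (8 * K))))"
  define B where "B i = {s \<in> space M. \<bar>tr_inner (A i) (sample_cov n (\<lambda>i. X i s) - \<Sigma>)\<bar> \<ge> \<tau>}" for i
  have K_eq: "K = op_norm \<Sigma> * norm (A i)" for i
    by (simp add: K_def tr_orthonormal_basis_sym_mats(2)[OF A V])
  have B: "B i \<in> sets M" "measure M (B i) \<le> 2 * b" for i
    unfolding B_def b_def
    using sample_cov_deviation_two_sided_tail[OF M n ind X \<Sigma> tr_orthonormal_basis_sym_mats(1)[OF A V] K_eq K \<tau>]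
    by blast+
  have "measure M {s \<in> space M. norm (\<theta>hat s - \<theta>0) > \<epsilon>} \<le> measure M (\<Union>i. B i)"
  proof (rule finite_measure_mono_AE)
    show "AE s in M. s \<in> {s \<in> space M. norm (\<theta>hat s - \<theta>0) > \<epsilon>} \<longrightarrow> s \<in> (\<Union>i. B i)"
      using est
    proof eventually_elim
      case (elim s)
      show ?case
        using bregman_estimate_outside_ball_coordinate[OF F \<Sigma> \<theta>0 elim sc pos(1) _ pos(2)]
        by (auto simp: B_def \<tau>_def d_def)
    qed
    show "(\<Union>i. B i) \<in> sets M"
      using B(1) by (intro sets.finite_UN) auto
  qed
  also have "\<dots> \<le> (\<Sum>i\<in>UNIV. measure M (B i))"
    using B(1) by (intro measure_UNION_le) auto
  also have "\<dots> \<le> (\<Sum>i\<in>(UNIV::'d set). 2 * b)"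
    by (intro sum_mono B(2))
  also have "\<dots> = 2 * d * b" by (simp add: d_def)
  also have "2 * d * b = (if \<epsilon> \<le> 2 * K * sqrt d / \<mu>
      then 2 * d * exp (- (\<mu>\<^sup>2 * \<epsilon>\<^sup>2 * real n / (32 * d * K\<^sup>2)))
      else 2 * d * exp (- (\<mu> * \<epsilon> * real n / (16 * sqrt d * K))))"
  proof -
    have "\<tau> \<le> K \<longleftrightarrow> \<epsilon> \<le> 2 * K * sqrt d / \<mu>"
      using pos d by (simp add: \<tau>_def divide_simps mult_ac)
    moreover have "real n * \<tau>\<^sup>2 / (8 * K\<^sup>2) = \<mu>\<^sup>2 * \<epsilon>\<^sup>2 * real n / (32 * d * K\<^sup>2)"
      using d by (simp add: \<tau>_def power_divide power_mult_distrib mult_ac)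
    moreover have "real n * \<tau> / (8 * K) = \<mu> * \<epsilon> * real n / (16 * sqrt d * K)"
      by (simp add: \<tau>_def mult_ac)
    ultimately show ?thesis by (simp add: b_def)
  qed
  finally show ?thesis by (simp only: d_def K_def)
qed

theorem theorem4p6:
  fixes M :: "'a measure"
    and F :: "real^'m^'m \<Rightarrow> ereal"
    and \<L> :: "(real^'m^'m) set"
    and A :: "'d::finite \<Rightarrow> real^'m^'m"
    and \<Sigma>0 :: "real^'m^'m"
    and \<theta>0 :: "real^'d"
    and n :: nat
    and X :: "nat \<Rightarrow> 'a \<Rightarrow> real^'m"
    and \<theta>hat :: "'a \<Rightarrow> real^'d"
  assumes "F \<in> bregman_class"
    and "subspace \<L>" and "\<L> \<subseteq> sym_mats"
    and "tr_orthonormal_basis A \<L>"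
    and "\<Sigma>0 \<in> pd_mats"
    and "sym_gradient F \<Sigma>0 \<in> \<L> \<inter> gradient_domain F"
    and "lin_param A \<theta>0 = sym_gradient F \<Sigma>0"
    and "prob_space M"
    and "n \<ge> 1"
    and "prob_space.indep_vars M (\<lambda>_. borel) X {1..n}"
    and "\<And>i. i \<in> {1..n} \<Longrightarrow> distributed M lborel (X i) (\<lambda>x. ennreal (mvnormal_density 0 \<Sigma>0 x))"
    and "\<theta>hat \<in> borel_measurable M"
    and "AE s in M. is_bregman_estimate F A (sample_cov n (\<lambda>i. X i s)) (\<theta>hat s)"
  shows "(\<forall>\<epsilon>>0. \<forall>\<mu>>0. strongly_convex_in_ball \<mu> \<epsilon> (excess_loss F A \<Sigma>0 \<theta>0) \<longrightarrow>
            \<P>(s in M. norm (\<theta>hat s - \<theta>0) > \<epsilon>) \<le>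
              (if \<epsilon> \<le> 2 * op_norm \<Sigma>0 * sqrt (real CARD('d)) / \<mu>
               then 2 * real CARD('d) *
                      exp (- (\<mu>\<^sup>2 * \<epsilon>\<^sup>2 * real n / (32 * real CARD('d) * (op_norm \<Sigma>0)\<^sup>2)))
               else 2 * real CARD('d) *
                      exp (- (\<mu> * \<epsilon> * real n / (16 * sqrt (real CARD('d)) * op_norm \<Sigma>0))))) \<and>
         (\<forall>\<delta>\<in>{0<..<1}. \<forall>\<mu>>0. \<forall>\<epsilon>.
            real n \<ge> 8 * ln (2 * real CARD('d) / \<delta>) \<longrightarrow>
            \<epsilon> = 4 * op_norm \<Sigma>0 / \<mu> *
                  sqrt (2 * real CARD('d) / real n * ln (2 * real CARD('d) / \<delta>)) \<longrightarrow>
            strongly_convex_in_ball \<mu> \<epsilon> (excess_loss F A \<Sigma>0 \<theta>0) \<longrightarrow>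
            \<P>(s in M. norm (\<theta>hat s - \<theta>0) \<le> \<epsilon>) \<ge> 1 - \<delta>)"
proof -
  interpret prob_space M by fact
  have main: "\<P>(s in M. norm (\<theta>hat s - \<theta>0) > \<epsilon>) \<le>
      (if \<epsilon> \<le> 2 * op_norm \<Sigma>0 * sqrt (real CARD('d)) / \<mu>
       then 2 * real CARD('d) *
              exp (- (\<mu>\<^sup>2 * \<epsilon>\<^sup>2 * real n / (32 * real CARD('d) * (op_norm \<Sigma>0)\<^sup>2)))
       else 2 * real CARD('d) *
              exp (- (\<mu> * \<epsilon> * real n / (16 * sqrt (real CARD('d)) * op_norm \<Sigma>0))))"
    if "\<epsilon> > 0" "\<mu> > 0" "strongly_convex_in_ball \<mu> \<epsilon> (excess_loss F A \<Sigma>0 \<theta>0)" for \<epsilon> \<mu>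
    using bregman_estimate_deviation[OF assms(1,3,4,5,7-11,13) that] .
  show ?thesis
  proof (intro conjI ballI allI impI)
    fix \<delta> \<mu> \<epsilon> :: real
    define d where "d = real CARD('d)"
    define K where "K = op_norm \<Sigma>0"
    define l where "l = ln (2 * d / \<delta>)"
    assume \<delta>: "\<delta> \<in> {0<..<1}" and \<mu>: "\<mu> > 0"
      and "real n \<ge> 8 * ln (2 * real CARD('d) / \<delta>)"
      and "\<epsilon> = 4 * op_norm \<Sigma>0 / \<mu> * sqrt (2 * real CARD('d) / real n * ln (2 * real CARD('d) / \<delta>))"
      and sc: "strongly_convex_in_ball \<mu> \<epsilon> (excess_loss F A \<Sigma>0 \<theta>0)"
    then have n: "real n \<ge> 8 * l" and \<epsilon>: "\<epsilon> = 4 * K / \<mu> * sqrt (2 * d / real n * l)"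
      by (simp_all only: d_def K_def l_def)
    have "d \<ge> 1" by (simp add: d_def Suc_le_eq)
    have "K > 0" by (simp add: K_def op_norm_pos assms)
    have n0: "real n > 0" using \<open>n \<ge> 1\<close> by simp
    have "l > 0" unfolding l_def using \<delta> \<open>d \<ge> 1\<close> by (intro ln_gt_zero) (simp add: less_divide_eq)
    have "\<epsilon> > 0" unfolding \<epsilon> using \<open>K > 0\<close> \<open>l > 0\<close> \<open>d \<ge> 1\<close> n0 \<mu> by simp
    \<comment> \<open>The sample size condition puts this radius into the Gaussian regime of the tail bound.\<close>
    have "\<epsilon> \<le> 2 * K * sqrt d / \<mu>"
    proof -
      have "2 * d / real n * l \<le> d / 4"
      proof -
        have "d * (8 * l) \<le> d * real n" using n \<open>d \<ge> 1\<close> by (intro mult_left_mono) auto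
        then show ?thesis using n0 by (simp add: divide_simps)
      qed
      then have "sqrt (2 * d / real n * l) \<le> sqrt (d / 4)" by (rule real_sqrt_le_mono)
      also have "\<dots> = sqrt d / 2" by (simp add: real_sqrt_divide)
      finally have "4 * K / \<mu> * sqrt (2 * d / real n * l) \<le> 4 * K / \<mu> * (sqrt d / 2)"
        using \<open>K > 0\<close> \<mu> by (intro mult_left_mono) auto
      then show ?thesis by (simp add: \<epsilon>)
    qed
    then have "\<P>(s in M. norm (\<theta>hat s - \<theta>0) > \<epsilon>) \<le>
        2 * d * exp (- (\<mu>\<^sup>2 * \<epsilon>\<^sup>2 * real n / (32 * d * K\<^sup>2)))"
      using main[OF \<open>\<epsilon> > 0\<close> \<mu> sc] by (simp only: d_def K_def if_True)
    also have "\<mu>\<^sup>2 * \<epsilon>\<^sup>2 * real n / (32 * d * K\<^sup>2) = l"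
    proof -
      have "\<epsilon>\<^sup>2 = 16 * K\<^sup>2 / \<mu>\<^sup>2 * (2 * d / real n * l)"
        unfolding \<epsilon> power_mult_distrib power_divide
        using \<open>l > 0\<close> \<open>d \<ge> 1\<close> n0 by (simp add: real_sqrt_pow2)
      then show ?thesis using \<mu> \<open>K > 0\<close> \<open>d \<ge> 1\<close> n0 by simp
    qed
    also have "2 * d * exp (- l) = \<delta>"
      using \<delta> \<open>d \<ge> 1\<close> by (simp add: l_def exp_minus)
    finally have "\<P>(s in M. norm (\<theta>hat s - \<theta>0) > \<epsilon>) \<le> \<delta>" .
    moreover have "\<P>(s in M. \<not> norm (\<theta>hat s - \<theta>0) > \<epsilon>) = 1 - \<P>(s in M. norm (\<theta>hat s - \<theta>0) > \<epsilon>)"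
    proof (rule prob_neg)
      note [measurable] = \<open>\<theta>hat \<in> borel_measurable M\<close>
      show "{s \<in> space M. norm (\<theta>hat s - \<theta>0) > \<epsilon>} \<in> events" by measurable
    qed
    ultimately show "\<P>(s in M. norm (\<theta>hat s - \<theta>0) \<le> \<epsilon>) \<ge> 1 - \<delta>"
      by (simp add: not_less)
  qed (rule main)
qed

end
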